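(* Let $q=3^f$ with $f\ge1$. Let $W=\mathbb{F}_q^2$ with the group law $(a,b)+(a',b')=(a+a',\,b+b'-aa'(a+a'))$ (the $3$-typical Witt vectors of length $2$ over $\mathbb{F}_q$). Let $\xi\colon W\to\mathbb{C}^\times$ be a character whose restriction to $\{0\}\times\mathbb{F}_q$ is nontrivial (its values are $9$-th roots of unity), and put $S_\xi=\sum_{x\in\mathbb{F}_q}\xi(x,0)\in\mathbb{Q}(\zeta_9)$, where $\zeta_9=e^{2\pi i/9}$. Let $\mathfrak{p}$ be the prime of $\mathbb{Q}(\zeta_9)$ above $3$ and $v_{\mathfrak{p}}$ the associated valuation normalized by $v_{\mathfrak{p}}(3)=1$. Then $v_{\mathfrak{p}}(S_\xi)=f/3$. *)

theory Defs
  imports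
    "HOL-Algebra.Generated_Fields"
    "HOL-Algebra.Ideal_Product"
    "HOL-Algebra.Algebraic_Closure_Type"
    "HOL-Number_Theory.Residues"
    "HOL-Library.Cardinality"
    "HOL-Library.Extended_Real"
    Complex_Main
begin

text \<open>
  The \<open>3\<close>-typical Witt vectors of length 2.  The second component of the sum involves
  \<open>(a^3 + a'^3 - (a + a')^3) / 3 = - a a' (a + a')\<close>.
\<close>

definition witt2 :: "('a::comm_ring_1 \<times> 'a) monoid" where
  "witt2 = \<lparr>carrier = UNIV,
     monoid.mult = (\<lambda>(a, b) (a', b'). (a + a', b + b' - a * a' * (a + a'))),
     one = (0, 0)\<rparr>"

lemma witt2_simps [simp]:
  "carrier witt2 = UNIV"
  "(a, b) \<otimes>\<^bsub>witt2\<^esub> (a', b') = (a + a', b + b' - a * a' * (a + a'))"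
  "\<one>\<^bsub>witt2\<^esub> = (0, 0)"
  by (simp_all add: witt2_def)

lemma comm_group_witt2: "comm_group (witt2 :: ('a::comm_ring_1 \<times> 'a) monoid)"
proof (rule comm_groupI)
  fix x :: "'a \<times> 'a"
  have "(- fst x, - snd x) \<otimes>\<^bsub>witt2\<^esub> x = \<one>\<^bsub>witt2\<^esub>"
    by (cases x) simp
  then show "\<exists>y \<in> carrier witt2. y \<otimes>\<^bsub>witt2\<^esub> x = \<one>\<^bsub>witt2\<^esub>"
    by auto
qed (auto simp: algebra_simps)

text \<open>The complex numbers as a ring in the sense of HOL-Algebra.\<close>

abbreviation complex_ring :: "complex ring" where
  "complex_ring \<equiv> ring_of_type_algebra"

definition zeta9 :: complex where
  "zeta9 = exp (2 * of_real pi * \<i> / 9)"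

text \<open>The field \<open>\<rat>(\<zeta>\<^sub>9)\<close>; every subfield of \<open>\<complex>\<close> contains \<open>\<rat>\<close>.\<close>

definition Q_zeta9 :: "complex set" where
  "Q_zeta9 = generate_field complex_ring {zeta9}"

definition ring_of_integers :: "complex set \<Rightarrow> complex ring" where
  "ring_of_integers K = complex_ring \<lparr>carrier := {x \<in> K. algebraic_int x}\<rparr>"

text \<open>
  For a nonzero prime ideal \<open>P\<close> of the ring of integers of a number field \<open>K\<close>: the exponent of
  the largest power of \<open>P\<close> containing a nonzero integer \<open>a\<close> (the exponent of \<open>P\<close> in the
  factorization of the principal ideal generated by \<open>a\<close>), and its extension to
  \<open>K - {0}\<close> through \<open>a / b \<mapsto> ord a - ord b\<close>.
\<close>

definition ideal_ord :: "complex set \<Rightarrow> complex set \<Rightarrow> complex \<Rightarrow> nat" where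
  "ideal_ord K P a = (GREATEST n. a \<in> P [^]\<^bsub>ideals_set (ring_of_integers K)\<^esub> n)"

definition prime_ord :: "complex set \<Rightarrow> complex set \<Rightarrow> complex \<Rightarrow> int" where
  "prime_ord K P x = (THE k. \<exists>a \<in> carrier (ring_of_integers K) - {0}.
      \<exists>b \<in> carrier (ring_of_integers K) - {0}.
        x = a / b \<and> k = int (ideal_ord K P a) - int (ideal_ord K P b))"

text \<open>
  The valuation attached to \<open>P\<close>, rescaled so that the rational prime \<open>p\<close> below \<open>P\<close> has value 1;
  the value at 0 is infinite.
\<close>

definition normalized_valuation ::
    "complex set \<Rightarrow> complex set \<Rightarrow> nat \<Rightarrow> complex \<Rightarrow> ereal" where
  "normalized_valuation K P p x =
     (if x = 0 then \<infinity>
      else ereal (real_of_int (prime_ord K P x) / real_of_int (prime_ord K P (of_nat p))))"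

lemma Q_zeta9_closed:
  "1 \<in> Q_zeta9" "zeta9 \<in> Q_zeta9"
  "x \<in> Q_zeta9 \<Longrightarrow> y \<in> Q_zeta9 \<Longrightarrow> x + y \<in> Q_zeta9"
  "x \<in> Q_zeta9 \<Longrightarrow> y \<in> Q_zeta9 \<Longrightarrow> x * y \<in> Q_zeta9"
  using generate_field.one[of complex_ring "{zeta9}"] generate_field.incl[of zeta9 "{zeta9}" complex_ring]
    generate_field.eng_add[of x complex_ring "{zeta9}" y]
    generate_field.eng_mult[of x complex_ring "{zeta9}" y]
  by (auto simp: Q_zeta9_def ring_of_type_algebra_def)

lemma witt2_character_power_9:
  fixes \<xi> :: "'a::{field,finite} \<times> 'a \<Rightarrow> complex"
  assumes "CARD('a) = 3 ^ f" and "\<xi> \<in> hom witt2 (units_of complex_ring)"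
  shows "\<xi> w ^ 9 = 1"
proof -
  have "of_nat CARD('a) = (0::'a)"
    using CHAR_dvd_CARD[where 'a='a] by (simp add: of_nat_eq_0_iff_char_dvd)
  then have "(3::'a) ^ f = 0"
    by (simp add: assms)
  then have 3: "(3::'a) = 0"
    by simp
  have nz: "\<xi> x \<noteq> 0" for x
  proof -
    have "\<xi> x \<in> Units complex_ring"
      using assms(2) by (cases x) (simp add: hom_def Pi_def units_of_carrier)
    then show ?thesis
      by (auto simp: Units_def ring_of_type_algebra_def)
  qed
  have mult: "\<xi> (x \<otimes>\<^bsub>witt2\<^esub> y) = \<xi> x * \<xi> y" for x y
    using hom_mult[OF assms(2), of x y] by (simp add: units_of_mult ring_of_type_algebra_def)
  have 6: "(6::'a) = 0"
    using arg_cong[OF 3, of "\<lambda>x. 2 * x"] by simp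
  have triple: "(x \<otimes>\<^bsub>witt2\<^esub> x) \<otimes>\<^bsub>witt2\<^esub> x = (0, - 2 * fst x ^ 3)" for x :: "'a \<times> 'a"
    by (cases x) (simp add: power3_eq_cube algebra_simps 3 6)
  have "\<xi> (0, 0) * \<xi> (0, 0) = \<xi> (0, 0)"
    using mult[of "(0, 0)" "(0, 0)"] by simp
  then have one: "\<xi> (0, 0) = 1"
    using nz by simp
  have cube: "\<xi> x ^ 3 = \<xi> (0, - 2 * fst x ^ 3)" for x
    using triple[of x] mult[of x x] mult[of "x \<otimes>\<^bsub>witt2\<^esub> x" x] by (simp add: power3_eq_cube)
  have "\<xi> w ^ 9 = (\<xi> w ^ 3) ^ 3"
    by (simp flip: power_mult)
  also have "\<dots> = 1"
    by (simp add: cube one)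
  finally show ?thesis .
qed

lemma witt2_character_sum_in_Q_zeta9:
  fixes \<xi> :: "'a::{field,finite} \<times> 'a \<Rightarrow> complex"
  assumes "CARD('a) = 3 ^ f" and "\<xi> \<in> hom witt2 (units_of complex_ring)"
  shows "(\<Sum>x\<in>UNIV. \<xi> (x, 0)) \<in> Q_zeta9"
proof -
  have pow: "zeta9 ^ k \<in> Q_zeta9" for k
    by (induction k) (auto intro: Q_zeta9_closed)
  have mem: "\<xi> w \<in> Q_zeta9" for w
  proof -
    have "\<xi> w ^ 9 = 1"
      using assms by (rule witt2_character_power_9)
    then obtain k where "\<xi> w = exp (2 * of_real pi * \<i> * of_nat k / 9)"
      using bij_betw_roots_unity[of 9] by (force simp: bij_betw_def cis_conv_exp mult_ac)
    also have "\<dots> = zeta9 ^ k"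
      by (simp add: zeta9_def mult_ac flip: exp_of_nat_mult)
    finally show ?thesis using pow by simp
  qed
  have ne: "(\<Sum>x\<in>A. \<xi> (x, 0)) \<in> Q_zeta9" if "finite A" "A \<noteq> {}" for A
    using that by (induction rule: finite_ne_induct) (auto intro: Q_zeta9_closed mem)
  show ?thesis by (rule ne) auto
qed

end

theory Submission
  imports Defs
begin

text \<open>
  Put \<open>\<pi> = \<zeta>\<^sub>9 - 1\<close>, so that \<open>3\<close> is \<open>\<pi>\<^sup>6\<close> times a unit. Cubing \<open>\<xi> (x, 0)\<close> gives an additive
  character of \<open>F\<^sub>q\<close> whose exponent is a nonzero functional \<open>l\<close> with values in \<open>{-1, 0, 1}\<close>.
  The coordinates \<open>N\<^sub>u(x) = l(u x)\<close>, for \<open>u\<close> in a suitable basis \<open>U\<close>, identify \<open>F\<^sub>q\<close> with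
  \<open>{-1, 0, 1}\<^sup>f\<close>. Let \<open>J\<close> be the ring generated by \<open>\<pi>\<close> and the functions \<open>\<pi> N\<^sub>u\<close>, filtered by degree.
  Since \<open>\<Sum>N\<^sub>u\<^sup>m\<close> is 3, 0 or 2 along each coordinate, functions in \<open>J\<close> have sums divisible by \<open>\<pi>\<^bsup>2f\<^esup>\<close>,
  and the group law shows that \<open>F\<^sub>w(x) = \<xi> (w x, 0)\<close> lies in \<open>J\<close>, with \<open>F\<^sub>u \<equiv> 1 + \<pi> N\<^sub>u\<close> up to
  degree 2. Modulo \<open>\<pi> J\<close> the family \<open>F\<close> is multiplicative in \<open>w\<close>, so by a Nakayama argument it
  spans \<open>J\<close>. As \<open>\<Prod>(\<pi> N\<^sub>u)\<^sup>2\<close> has sum \<open>2\<^sup>f \<pi>\<^bsup>2f\<^esup>\<close> and all \<open>F\<^sub>w\<close> with \<open>w \<noteq> 0\<close> have the same sum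
  \<open>S\<^sub>\<xi>\<close>, the valuation of \<open>S\<^sub>\<xi>\<close> at \<open>\<pi>\<close> is exactly \<open>2f\<close>.
\<close>

section \<open>The uniformizer \<open>\<zeta>\<^sub>9 - 1\<close>\<close>

lemma zeta9_power_9: "zeta9 ^ 9 = 1"
proof -
  have "zeta9 ^ 9 = exp (of_nat 9 * (2 * of_real pi * \<i> / 9))"
    unfolding zeta9_def by (rule exp_of_nat_mult [symmetric])
  also have "of_nat 9 * (2 * of_real pi * \<i> / 9) = 2 * of_real pi * \<i>"
    by simp
  also have "exp \<dots> = 1"
    by (rule exp_two_pi_i)
  finally show ?thesis .
qed

lemma root_of_unity_9: "z ^ 9 = 1 \<Longrightarrow> \<exists>k. z = zeta9 ^ k"
proof -
  assume "z ^ 9 = 1"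
  then obtain k where "z = exp (2 * of_real pi * \<i> * of_nat k / 9)"
    using bij_betw_roots_unity[of 9] by (force simp: bij_betw_def cis_conv_exp mult_ac)
  also have "\<dots> = zeta9 ^ k"
    by (simp add: zeta9_def mult_ac flip: exp_of_nat_mult)
  finally show ?thesis ..
qed

lemma zeta9_cube_neq_1: "zeta9 ^ 3 \<noteq> 1"
proof
  assume "zeta9 ^ 3 = 1"
  moreover have "zeta9 ^ 3 = exp (of_nat 3 * (2 * of_real pi * \<i> / 9))"
    unfolding zeta9_def by (rule exp_of_nat_mult [symmetric])
  moreover have "\<dots> = cis (2 * pi / 3)"
    by (simp add: cis_conv_exp mult_ac)
  ultimately have "cos (2 * pi / 3) = 1"
    by (simp add: complex_eq_iff)
  then show False
    by (simp add: cos_120)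
qed

lemma zeta9_primitive: "zeta9 ^ 6 + zeta9 ^ 3 + 1 = 0"
proof -
  have "(zeta9 ^ 3 - 1) * (zeta9 ^ 6 + zeta9 ^ 3 + 1) = zeta9 ^ 9 - 1"
    by (simp add: algebra_simps flip: power_add)
  then show ?thesis
    using zeta9_power_9 zeta9_cube_neq_1 by simp
qed

text \<open>\<open>zeta9 ^ 3\<close> is a primitive cube root of unity, so the class modulo 3 of an
  exponent \<open>r\<close> can be read off from the cube of \<open>zeta9 ^ r\<close>.\<close>

lemma zeta9_power_3_eq_1: "zeta9 ^ (r * 3) = 1 \<longleftrightarrow> 3 dvd r"
proof -
  have "r * 3 = 9 * (r div 3) + 3 * (r mod 3)"
    by presburger
  then have "zeta9 ^ (r * 3) = (zeta9 ^ 9) ^ (r div 3) * zeta9 ^ (3 * (r mod 3))"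
    by (simp only: power_add power_mult)
  moreover have "r mod 3 = 0 \<or> r mod 3 = 1 \<or> r mod 3 = 2"
    by presburger
  moreover have "zeta9 ^ 6 \<noteq> 1"
    using zeta9_cube_neq_1 zeta9_power_9 power_add[of zeta9 6 3] by force
  ultimately show ?thesis
    using zeta9_cube_neq_1 by (auto simp: zeta9_power_9 dvd_eq_mod_eq_0)
qed

definition \<pi> :: complex where
  "\<pi> = zeta9 - 1"

lemma pi_nonzero: "\<pi> \<noteq> 0"
  using zeta9_cube_neq_1 by (auto simp: \<pi>_def)

text \<open>The ninth cyclotomic polynomial expanded at \<open>1 + \<pi>\<close>, its leading term
  on the right. It makes \<open>\<pi> ^ 6 / 3\<close> an integer polynomial in
  \<open>\<pi>\<close>.\<close>

lemma three_pi_expansion: "3 * (1 + 3 * \<pi> + 6 * \<pi>^2 + 7 * \<pi>^3 + 5 * \<pi>^4 + 2 * \<pi>^5) = - (\<pi> ^ 6)"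
    (is "?l = _")
proof -
  have "3 * (1 + 3 * \<pi> + 6 * \<pi>^2 + 7 * \<pi>^3 + 5 * \<pi>^4 + 2 * \<pi>^5) =
      (1 + \<pi>) ^ 6 + (1 + \<pi>) ^ 3 + 1 - \<pi> ^ 6"
    for \<pi> :: complex
    by Groebner_Basis.algebra
  from this[of \<pi>] have "?l = - (\<pi> ^ 6) + (zeta9 ^ 6 + zeta9 ^ 3 + 1)"
    by (simp only: \<pi>_def) simp
  then show ?thesis
    by (simp only: zeta9_primitive) simp
qed

text \<open>The converse divisibility to \<open>three_pi_expansion\<close>: 3 and
  \<open>\<pi> ^ 6\<close> are associates.\<close>

lemma three_over_pi_power:
  "3 / \<pi> ^ 6 = 10 + 11 * zeta9 + 7 * zeta9^2 + 10 * zeta9^3 + 4 * zeta9^4 - 4 * zeta9^5"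
    (is "_ = ?y")
proof -
  \<comment> \<open>A Bezout identity writing 3 in terms of \<open>(z - 1) ^ 6\<close> and the ninth
    cyclotomic polynomial, which vanishes at \<open>zeta9\<close>.\<close>
  have "(10 + 11 * z + 7 * z^2 + 10 * z^3 + 4 * z^4 - 4 * z^5) * (z - 1) ^ 6 - 3 =
      (z ^ 6 + z ^ 3 + 1) * (7 - 49 * z + 91 * z^2 - 74 * z^3 + 28 * z^4 - 4 * z^5)"
    for z :: complex
    by Groebner_Basis.algebra
  from this[of zeta9] have "?y * \<pi> ^ 6 = 3"
    by (simp add: zeta9_primitive \<pi>_def)
  then show ?thesis
    using pi_nonzero by (simp add: divide_eq_eq)
qed

section \<open>Filtration of a ring by powers of \<open>\<pi>\<close>\<close>

locale uniformized_ring =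
  fixes R :: "complex set"
  assumes one_closed: "1 \<in> R"
    and add_closed: "x \<in> R \<Longrightarrow> y \<in> R \<Longrightarrow> x + y \<in> R"
    and uminus_closed: "x \<in> R \<Longrightarrow> - x \<in> R"
    and mult_closed: "x \<in> R \<Longrightarrow> y \<in> R \<Longrightarrow> x * y \<in> R"
    and zeta9_closed: "zeta9 \<in> R"
    and half_closed: "1 / 2 \<in> R"
    and pi_nonunit: "1 / \<pi> \<notin> R"
begin

definition I :: "nat \<Rightarrow> complex set" where
  "I n = {x. x / \<pi> ^ n \<in> R}"

lemma I_0: "I 0 = R"
  by (simp add: I_def)

lemma zero_closed: "0 \<in> R"
  using add_closed[OF one_closed uminus_closed[OF one_closed]] by simp

lemma I_zero [simp]: "0 \<in> I n"
  by (simp add: I_def zero_closed)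

lemma power_closed: "x \<in> R \<Longrightarrow> x ^ n \<in> R"
  by (induction n) (auto intro: mult_closed one_closed)

lemma pi_closed: "\<pi> \<in> R"
  using add_closed[OF zeta9_closed uminus_closed[OF one_closed]] by (simp add: \<pi>_def)

lemma three_closed: "3 / \<pi> ^ 6 \<in> R"
proof -
  have n: "of_nat n \<in> R" for n
    by (induction n) (auto intro: add_closed one_closed zero_closed)
  have "10 \<in> R" "11 \<in> R" "7 \<in> R" "4 \<in> R"
    using n[of 10] n[of 11] n[of 7] n[of 4] by simp_all
  then show ?thesis
    unfolding three_over_pi_power diff_conv_add_uminus
    by (intro mult_closed add_closed uminus_closed zeta9_closed power_closed)
qed

lemma I_add: "x \<in> I n \<Longrightarrow> y \<in> I n \<Longrightarrow> x + y \<in> I n"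
  by (simp add: I_def add_closed add_divide_distrib)

lemma I_uminus: "x \<in> I n \<Longrightarrow> - x \<in> I n"
  by (simp add: I_def uminus_closed)

lemma I_diff: "x \<in> I n \<Longrightarrow> y \<in> I n \<Longrightarrow> x - y \<in> I n"
  using I_add[OF _ I_uminus, of x n y] by simp

lemma I_mult: "x \<in> I m \<Longrightarrow> y \<in> I n \<Longrightarrow> x * y \<in> I (m + n)"
  using mult_closed[of "x / \<pi> ^ m" "y / \<pi> ^ n"] by (simp add: I_def power_add)

lemma I_one: "1 \<in> I 0"
  by (simp add: I_def one_closed)

lemma I_pi: "\<pi> \<in> I 1"
  by (simp add: I_def one_closed pi_nonzero)

lemma I_power: "x \<in> I n \<Longrightarrow> x ^ k \<in> I (k * n)"
  by (induction k) (auto intro: I_mult simp: I_one)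

lemma I_pi_power: "\<pi> ^ n \<in> I n"
  using I_power[OF I_pi, of n] by simp

lemma I_Suc: "x \<in> I (Suc n) \<Longrightarrow> x \<in> I n"
  using mult_closed[OF pi_closed, of "x / \<pi> ^ Suc n"] by (simp add: I_def pi_nonzero)

lemma I_mono: "x \<in> I n \<Longrightarrow> m \<le> n \<Longrightarrow> x \<in> I m"
  by (induction n arbitrary: m) (auto intro: I_Suc simp: le_Suc_eq)

lemma I_mult0: "x \<in> R \<Longrightarrow> y \<in> I n \<Longrightarrow> x * y \<in> I n"
  using I_mult[of x 0 y n] by (simp add: I_0)

lemma I_mult_le: "x \<in> I m \<Longrightarrow> y \<in> I n \<Longrightarrow> k \<le> m + n \<Longrightarrow> x * y \<in> I k"
  by (rule I_mono[OF I_mult])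

lemma I_sum: "(\<And>i. i \<in> A \<Longrightarrow> g i \<in> I n) \<Longrightarrow> sum g A \<in> I n"
  by (induction A rule: infinite_finite_induct) (auto intro: I_add)

lemma I_prod: "(\<And>i. i \<in> A \<Longrightarrow> g i \<in> I (n i)) \<Longrightarrow> prod g A \<in> I (sum n A)"
  by (induction A rule: infinite_finite_induct) (auto intro: I_mult I_one)

lemma I_of_nat: "of_nat n \<in> I 0"
  by (induction n) (auto intro: I_add I_one)

lemma I_of_int: "of_int n \<in> I 0"
  by (cases n) (auto simp del: of_nat_Suc intro: I_of_nat I_uminus)

lemma I_3: "3 \<in> I 6"
  by (simp add: I_def three_closed)

lemma I_half: "1 / 2 \<in> I 0"
  by (simp add: I_def half_closed)

text \<open>2 is a unit of \<open>R\<close>, so membership would put \<open>1 / \<pi>\<close> into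
  \<open>R\<close>.\<close>

lemma two_power_nonmember: "\<pi> ^ n * 2 ^ k \<notin> I (Suc n)"
proof
  assume "\<pi> ^ n * 2 ^ k \<in> I (Suc n)"
  then have "(1 / 2) ^ k * (\<pi> ^ n * 2 ^ k) \<in> I (Suc n)"
    using I_mult0[of "(1/2)^k"] I_power[OF I_half, of k] by (simp add: I_0)
  then have "\<pi> ^ n \<in> I (Suc n)"
    by (simp add: power_divide)
  then show False
    using pi_nonunit pi_nonzero by (simp add: I_def divide_simps)
qed

lemma I_root_of_unity: "z ^ 9 = 1 \<Longrightarrow> z \<in> I 0"
  using root_of_unity_9[of z] by (auto simp: I_0 intro: power_closed zeta9_closed)

text \<open>Expand \<open>(1 + \<pi>) ^ r\<close> to first order; changing \<open>r\<close> by a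
  multiple of 3 alters the linear term by a multiple of \<open>3 * \<pi>\<close>, which lies in
  \<open>I 2\<close>.\<close>

lemma I_pi_multiple:
  assumes "[int r = n] (mod 3)"
  shows "zeta9 ^ r - 1 - of_int n * \<pi> \<in> I 2"
proof -
  have 1: "zeta9 ^ r - 1 - of_nat r * \<pi> \<in> I 2"
  proof (induction r)
    case (Suc r)
    have "zeta9 ^ Suc r - 1 - of_nat (Suc r) * \<pi> =
        (zeta9 ^ r - 1 - of_nat r * \<pi>) * zeta9 + of_nat r * \<pi> ^ 2"
      by (simp add: \<pi>_def algebra_simps power2_eq_square)
    moreover have "of_nat r * \<pi> ^ 2 \<in> I 2"
      using I_mult[OF I_of_nat I_pi_power] by simp
    moreover have "(zeta9 ^ r - 1 - of_nat r * \<pi>) * zeta9 \<in> I 2"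
      using I_mult0[OF zeta9_closed Suc] by (simp add: mult.commute)
    ultimately show ?case
      by (simp only: I_add)
  qed simp
  obtain k where k: "int r - n = 3 * k"
    using assms by (auto simp: cong_iff_dvd_diff)
  have "of_int (int r - n) * \<pi> \<in> I 2"
    unfolding k using I_mult_le[OF I_mult_le[OF I_3 I_of_int[of k] order_refl] I_pi, of 2] by simp
  then show ?thesis
    using I_add[OF 1, of "of_int (int r - n) * \<pi>"]
    by (simp add: left_diff_distrib add.commute)
qed

text \<open>Such a \<open>z\<close> is a power of \<open>zeta9 ^ 3\<close>, and
  \<open>zeta9 ^ 3 - 1 = \<pi> ^ 3 + 3 * \<pi> * (\<pi> + 1)\<close>, where 3 is divisible by
  \<open>\<pi> ^ 6\<close>.\<close>

lemma I_cube_root: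
  assumes "z ^ 3 = 1"
  shows "z - 1 \<in> I 3"
proof -
  have "z ^ 9 = (z ^ 3) ^ 3"
    by (simp flip: power_mult)
  then obtain r where r: "z = zeta9 ^ r"
    using assms root_of_unity_9 by auto
  have "\<pi> ^ 3 + 3 * \<pi> * (\<pi> + 1) = (\<pi> + 1) ^ 3 - 1" for \<pi> :: complex
    by Groebner_Basis.algebra
  from this[of \<pi>] have 27: "\<pi> ^ 3 + 3 * \<pi> * (\<pi> + 1) = zeta9 ^ 3 - 1"
    by (simp add: \<pi>_def)
  have c: "zeta9 ^ 3 - 1 \<in> I 3"
    unfolding 27[symmetric]
    by (intro I_add I_pi_power I_mult_le[OF I_mult_le[OF I_3 I_pi order_refl], of _ 0])
       (auto simp: I_0 intro: add_closed pi_closed one_closed)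
  have "3 dvd r"
    using assms by (simp add: r zeta9_power_3_eq_1 flip: power_mult)
  then obtain s where s: "r = 3 * s"
    by auto
  have "z - 1 = (zeta9 ^ 3 - 1) * (\<Sum>i<s. (zeta9 ^ 3) ^ i)"
    by (simp add: r s power_mult power_diff_1_eq)
  moreover have "(\<Sum>i<s. (zeta9 ^ 3) ^ i) \<in> I 0"
    by (intro I_sum) (auto simp: I_0 intro: power_closed zeta9_closed)
  ultimately show ?thesis
    using I_mult[OF c] by fastforce
qed

text \<open>Lagrange interpolation of \<open>n \<mapsto> z\<^sup>n\<close> at the nodes \<open>-1, 0, 1\<close>.\<close>

lemma root_of_unity_interpolation:
  assumes z: "z ^ 9 = 1" "z - 1 \<in> I e"
  obtains a b where "a \<in> I e" "b \<in> I (2 * e)" "a - (z - 1) \<in> I (2 * e)"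
    "\<And>n. n \<in> {-1, 0, 1} \<Longrightarrow> z powi n = 1 + a * of_int n + b * of_int n ^ 2"
proof
  \<comment> \<open>The quadratic coefficient is \<open>(z + inverse z) / 2 - 1\<close>; with
    \<open>z ^ 8\<close> for the inverse, this form exhibits the factor \<open>(z - 1) ^ 2\<close>.
    The linear coefficient is \<open>z - 1 - b\<close>.\<close>
  define b where "b = 1 / 2 * z ^ 8 * (z - 1) ^ 2"
  have [simp]: "z \<noteq> 0"
    using z(1) by (metis power_0_left zero_neq_numeral zero_neq_one)
  have inv: "inverse z = z ^ 8"
    using power_Suc[of z 8] z(1) by (intro inverse_unique) simp
  show b: "b \<in> I (2 * e)"
    unfolding b_def using I_power[OF z(2), of 2] I_power[OF I_root_of_unity[OF z(1)], of 8]
    by (intro I_mult_le[OF I_mult_le[OF I_half, of "z ^ 8" 0 0], of _ "2 * e"]) simp_all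
  then show "(z - 1 - b) - (z - 1) \<in> I (2 * e)"
    by (simp add: I_uminus)
  show "z - 1 - b \<in> I e"
    using I_diff[OF z(2) I_mono[OF b, of e]] by simp
  have "1 / 2 * w * (z - 1) ^ 2 = (z + w) / 2 - 1" if "w * z = 1" for w z :: complex
    using that by Groebner_Basis.algebra
  from this[of "inverse z" z] have b2: "b = (z + inverse z) / 2 - 1"
    by (simp only: b_def inv[symmetric]) simp
  show "z powi n = 1 + (z - 1 - b) * of_int n + b * of_int n ^ 2" if n: "n \<in> {-1, 0, 1}" for n
  proof -
    consider "n = -1" | "n = 0" | "n = 1"
      using n by blast
    then show ?thesis
      by cases (simp_all add: power_int_minus b2)
  qed
qed

end

section \<open>Functions of ternary coordinates\<close>

locale ternary_coordinates = uniformized_ring R for R :: "complex set" +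
  fixes U :: "'i set" and N :: "'i \<Rightarrow> 'x::finite \<Rightarrow> int"
  assumes finite_U: "finite U"
    and N_range: "N u x \<in> {-1, 0, 1}"
    and bij_N: "bij_betw (\<lambda>x. \<lambda>u\<in>U. N u x) UNIV (PiE U (\<lambda>_. {-1, 0, 1}))"
begin

text \<open>
  Each coordinate has weight 1, like the uniformizer; a monomial carries at least as many
  factors \<open>\<pi>\<close> as its degree.
\<close>

inductive_set J :: "nat \<Rightarrow> ('x \<Rightarrow> complex) set" for k where
  J_monomial: "c \<in> I e \<Longrightarrow> k \<le> e \<Longrightarrow> (\<Sum>u\<in>U. m u) \<le> e \<Longrightarrow>
    (\<lambda>x. c * (\<Prod>u\<in>U. of_int (N u x) ^ m u)) \<in> J k"
| J_add: "g \<in> J k \<Longrightarrow> h \<in> J k \<Longrightarrow> (\<lambda>x. g x + h x) \<in> J k"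

lemma J_mono: "g \<in> J k \<Longrightarrow> j \<le> k \<Longrightarrow> g \<in> J j"
  by (induction rule: J.induct) (auto intro: J.intros order_trans)

lemma J_const: "c \<in> I k \<Longrightarrow> (\<lambda>_. c) \<in> J k"
  using J_monomial[of c k k "\<lambda>_. 0"] by simp

lemma J_zero: "(\<lambda>_. 0) \<in> J k"
  by (rule J_const) simp

lemma J_one: "(\<lambda>_. 1) \<in> J 0"
  by (rule J_const) (rule I_one)

lemma J_mult: "g \<in> J j \<Longrightarrow> h \<in> J k \<Longrightarrow> (\<lambda>x. g x * h x) \<in> J (j + k)"
proof (induction rule: J.induct)
  case (J_monomial c e m)
  from J_monomial.prems show ?case
  proof (induction rule: J.induct)
    case (J_monomial c' e' m')
    have "(\<lambda>x. (c * c') * (\<Prod>u\<in>U. of_int (N u x) ^ (m u + m' u))) \<in> J (j + k)"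
      using J_monomial.hyps \<open>c \<in> I e\<close> \<open>j \<le> e\<close> \<open>sum m U \<le> e\<close>
      by (intro J.J_monomial[where e = "e + e'"] I_mult) (auto simp: sum.distrib)
    then show ?case
      by (simp add: power_add prod.distrib mult_ac)
  next
    case (J_add g h)
    then show ?case
      by (simp add: distrib_left J.J_add)
  qed
next
  case (J_add g h)
  then show ?case
    by (simp add: distrib_right J.J_add)
qed

lemma J_mult_le: "g \<in> J j \<Longrightarrow> h \<in> J k \<Longrightarrow> n \<le> j + k \<Longrightarrow> (\<lambda>x. g x * h x) \<in> J n"
  by (rule J_mono[OF J_mult])

lemma J_scale: "c \<in> I j \<Longrightarrow> g \<in> J k \<Longrightarrow> (\<lambda>x. c * g x) \<in> J (j + k)"
  by (rule J_mult[OF J_const])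

lemma J_uminus: "g \<in> J k \<Longrightarrow> (\<lambda>x. - g x) \<in> J k"
  using J_scale[of "-1" 0 g k] I_uminus[OF I_one] by simp

lemma J_diff: "g \<in> J k \<Longrightarrow> h \<in> J k \<Longrightarrow> (\<lambda>x. g x - h x) \<in> J k"
  using J_add[OF _ J_uminus] by simp

lemma J_sum: "(\<And>i. i \<in> A \<Longrightarrow> g i \<in> J k) \<Longrightarrow> (\<lambda>x. \<Sum>i\<in>A. g i x) \<in> J k"
  by (induction A rule: infinite_finite_induct) (auto intro: J_add J_zero)

lemma J_coordinate:
  assumes "u \<in> U" "c \<in> I 1"
  shows "(\<lambda>x. c * of_int (N u x)) \<in> J 1"
proof -
  have "(\<lambda>x. c * (\<Prod>v\<in>U. of_int (N v x) ^ (if v = u then 1 else 0))) \<in> J 1"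
    using assms finite_U by (intro J_monomial[where e = 1]) auto
  also have "(\<lambda>x. c * (\<Prod>v\<in>U. of_int (N v x) ^ (if v = u then 1 else 0))) = (\<lambda>x. c * of_int (N u x))"
    using assms finite_U by (simp add: if_distrib[of "power _"] prod.delta cong: if_cong)
  finally show ?thesis .
qed

text \<open>The \<open>k\<close> factors \<open>\<pi>\<close> that \<open>g\<close> needs are taken
  out of \<open>c\<close>, so the total degree stays \<open>j\<close>.\<close>

lemma J_of_pi_power:
  assumes "c \<in> I j" "(\<lambda>x. \<pi> ^ k * g x) \<in> J k" "k \<le> j"
  shows "(\<lambda>x. c * g x) \<in> J j"
proof -
  have "c / \<pi> ^ k \<in> I (j - k)"
    using assms(1,3) pi_nonzero by (simp add: I_def flip: power_add)
  from J_scale[OF this assms(2)] show ?thesis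
    using assms(3) pi_nonzero by simp
qed

section \<open>Sums over all points\<close>

lemma sum_prod_coordinates:
  "(\<Sum>x\<in>UNIV. \<Prod>u\<in>U. g u (N u x)) = (\<Prod>u\<in>U. \<Sum>n\<in>{-1, 0, 1}. (g u n :: complex))"
proof -
  have "(\<Sum>x\<in>UNIV. \<Prod>u\<in>U. g u (N u x)) = (\<Sum>x\<in>UNIV. \<Prod>u\<in>U. g u ((\<lambda>u\<in>U. N u x) u))"
    by simp
  also have "\<dots> = (\<Sum>n\<in>PiE U (\<lambda>_. {-1, 0, 1}). \<Prod>u\<in>U. g u (n u))"
    by (rule sum.reindex_bij_betw[OF bij_N])
  also have "\<dots> = (\<Prod>u\<in>U. \<Sum>n\<in>{-1, 0, 1}. g u n)"
    by (rule prod_sum_PiE[symmetric]) (auto simp: finite_U)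
  finally show ?thesis .
qed

text \<open>The sum is 3 for \<open>m = 0\<close> and 0 for \<open>m = 1\<close>; for
  \<open>m \<ge> 2\<close> the truncated difference \<open>2 - m\<close> asks only for
  integrality.\<close>

lemma sum_ternary_power: "(\<Sum>n\<in>{-1, 0, 1::int}. of_int n ^ m) \<in> I (2 - m)"
proof -
  consider "m = 0" | "m = 1" | "m \<ge> 2"
    by linarith
  then show ?thesis
  proof cases
    case 3
    have "(\<Sum>n\<in>{-1, 0, 1::int}. complex_of_int (n ^ m)) \<in> I 0"
      by (rule I_sum) (rule I_of_int)
    then show ?thesis
      using 3 by simp
  qed (use I_mono[OF I_3, of 2] in auto)
qed

text \<open>In a monomial the exponent \<open>m u\<close> is paid for by \<open>e\<close>, and
  summing over coordinate \<open>u\<close> gains \<open>2 - m u\<close> more factors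
  \<open>\<pi>\<close>: at least 2 per coordinate.\<close>

lemma sum_J: "g \<in> J k \<Longrightarrow> (\<Sum>x\<in>UNIV. g x) \<in> I (max k (2 * card U))"
proof (induction rule: J.induct)
  case (J_monomial c e m)
  have "(\<Sum>x\<in>UNIV. c * (\<Prod>u\<in>U. of_int (N u x) ^ m u)) =
      c * (\<Prod>u\<in>U. \<Sum>n\<in>{-1, 0, 1::int}. of_int n ^ m u)"
    unfolding sum_distrib_left[symmetric]
    by (subst sum_prod_coordinates[of "\<lambda>u n. of_int n ^ m u", symmetric]) simp
  also have "\<dots> \<in> I (e + (\<Sum>u\<in>U. 2 - m u))"
    by (intro I_mult J_monomial I_prod sum_ternary_power)
  finally show ?case
  proof (rule I_mono)
    have "2 * card U = (\<Sum>u\<in>U. 2)"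
      by simp
    also have "\<dots> \<le> (\<Sum>u\<in>U. m u + (2 - m u))"
      by (rule sum_mono) simp
    also have "\<dots> \<le> e + (\<Sum>u\<in>U. 2 - m u)"
      using J_monomial by (simp add: sum.distrib)
    finally show "max k (2 * card U) \<le> e + (\<Sum>u\<in>U. 2 - m u)"
      using J_monomial by simp
  qed
qed (simp add: sum.distrib I_add)

text \<open>The function whose sum over all points has the smallest possible valuation.\<close>

lemma J_top: "(\<lambda>x. \<Prod>u\<in>U. (\<pi> * of_int (N u x)) ^ 2) \<in> J 0"
proof -
  have "(\<lambda>x. \<pi> ^ (2 * card U) * (\<Prod>u\<in>U. of_int (N u x) ^ 2)) \<in> J 0"
    using J_monomial[OF I_pi_power, of 0 "2 * card U" "\<lambda>_. 2"] by simp
  then show ?thesis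
    by (simp add: power_mult_distrib prod.distrib power_mult)
qed

text \<open>Each coordinate contributes \<open>2 * \<pi> ^ 2\<close>. As 2 is a unit, the bound of
  \<open>sum_J\<close> is attained.\<close>

lemma sum_top: "(\<Sum>x\<in>UNIV. \<Prod>u\<in>U. (\<pi> * of_int (N u x)) ^ 2) = \<pi> ^ (2 * card U) * 2 ^ card U"
  by (subst sum_prod_coordinates[of "\<lambda>u n. (\<pi> * of_int n) ^ 2"]) (simp add: power_mult_distrib power_mult)

text \<open>\<open>\<pi>\<close> times \<open>J 0\<close>. It lies in \<open>J 1\<close>, which has
  also the functions \<open>\<pi> * N u\<close>; sums over its members gain a full extra factor
  \<open>\<pi>\<close>.\<close>

definition pi_J :: "('x \<Rightarrow> complex) set" where
  "pi_J = {g. (\<lambda>x. g x / \<pi>) \<in> J 0}"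

lemma pi_J_add: "g \<in> pi_J \<Longrightarrow> h \<in> pi_J \<Longrightarrow> (\<lambda>x. g x + h x) \<in> pi_J"
  using J_add[of "\<lambda>x. g x / \<pi>" 0 "\<lambda>x. h x / \<pi>"] by (simp add: pi_J_def add_divide_distrib)

lemma pi_J_mult: "g \<in> J 0 \<Longrightarrow> h \<in> pi_J \<Longrightarrow> (\<lambda>x. g x * h x) \<in> pi_J"
  using J_mult[of g 0 "\<lambda>x. h x / \<pi>" 0] by (simp add: pi_J_def)

lemma pi_J_subset: "g \<in> pi_J \<Longrightarrow> g \<in> J 0"
  using J_mono[OF J_scale[OF I_pi, of "\<lambda>x. g x / \<pi>" 0], of 0] by (simp add: pi_J_def pi_nonzero)

lemma pi_J_const: "c \<in> I 1 \<Longrightarrow> (\<lambda>_. c) \<in> pi_J"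
  using J_const[of "c / \<pi>" 0] by (simp add: pi_J_def I_def)

lemma pi_J_zero: "(\<lambda>_. 0) \<in> pi_J"
  by (rule pi_J_const) simp

lemma sum_pi_J:
  assumes "g \<in> pi_J"
  shows "(\<Sum>x\<in>UNIV. g x) \<in> I (Suc (2 * card U))"
proof -
  have "\<pi> * (\<Sum>x\<in>UNIV. g x / \<pi>) \<in> I (1 + max 0 (2 * card U))"
    using assms by (intro I_mult I_pi sum_J) (simp add: pi_J_def)
  then show ?thesis
    by (simp add: pi_nonzero flip: sum_divide_distrib)
qed

end

section \<open>Spanning families\<close>

text \<open>The hypotheses of the Nakayama argument: the family is closed under products modulo
  \<open>pi_J\<close> and yields the generators \<open>\<pi> * N u\<close> to first order.\<close>

locale generating_family = ternary_coordinates R U N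
  for R :: "complex set" and U :: "'i set" and N :: "'i \<Rightarrow> 'x::finite \<Rightarrow> int" +
  fixes F :: "'w \<Rightarrow> 'x \<Rightarrow> complex"
  assumes F_J: "F w \<in> J 0"
    and F_one: "\<exists>w. F w = (\<lambda>_. 1)"
    and F_mult: "\<exists>t. (\<lambda>x. F v x * F w x - F t x) \<in> pi_J"
    and F_coordinate: "u \<in> U \<Longrightarrow> \<exists>w. (\<lambda>x. F w x - 1 - \<pi> * of_int (N u x)) \<in> J 2"
begin

text \<open>The \<open>R\<close>-span of the family, enlarged by \<open>pi_J\<close> to become a
  ring. The enlargement is harmless, as members of \<open>pi_J\<close> have sums in
  \<open>I (Suc (2 * card U))\<close>.\<close>

inductive_set B :: "('x \<Rightarrow> complex) set" where
  B_F: "F w \<in> B"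
| B_pi_J: "g \<in> pi_J \<Longrightarrow> g \<in> B"
| B_scale: "c \<in> R \<Longrightarrow> g \<in> B \<Longrightarrow> (\<lambda>x. c * g x) \<in> B"
| B_add: "g \<in> B \<Longrightarrow> h \<in> B \<Longrightarrow> (\<lambda>x. g x + h x) \<in> B"

lemma B_J: "g \<in> B \<Longrightarrow> g \<in> J 0"
proof (induction rule: B.induct)
  case (B_scale c g)
  then show ?case
    using J_scale[of c 0 g 0] by (simp add: I_0)
qed (auto intro: F_J pi_J_subset J_add)

lemma B_const: "c \<in> R \<Longrightarrow> (\<lambda>_. c) \<in> B"
proof -
  obtain w where w: "F w = (\<lambda>_. 1)"
    using F_one by blast
  show "c \<in> R \<Longrightarrow> (\<lambda>_. c) \<in> B"
    using B_scale[OF _ B_F[of w], of c] by (simp add: w)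
qed

text \<open>Products of two members of the family return to it modulo \<open>pi_J\<close>, which
  absorbs multiplication by \<open>J 0\<close>, hence by \<open>B\<close>.\<close>

lemma B_mult: "g \<in> B \<Longrightarrow> h \<in> B \<Longrightarrow> (\<lambda>x. g x * h x) \<in> B"
proof (induction rule: B.induct)
  case (B_F v)
  then show ?case
  proof (induction rule: B.induct)
    case (B_F w)
    obtain t where "(\<lambda>x. F v x * F w x - F t x) \<in> pi_J"
      using F_mult by blast
    from B_add[OF B.B_F[of t] B_pi_J[OF this]] show ?case
      by simp
  next
    case (B_scale c g)
    then show ?case
      using B.B_scale[of c "\<lambda>x. F v x * g x"] by (simp add: mult_ac)
  qed (auto simp: distrib_left intro: B_pi_J pi_J_mult F_J B_add)
next
  case (B_pi_J g)
  then show ?case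
    using pi_J_mult[OF B_J[OF B_pi_J.prems]] by (simp add: mult.commute B.B_pi_J)
qed (auto simp: distrib_right mult.assoc intro: B_scale B_add)

text \<open>The class of \<open>g\<close> in the graded piece \<open>J n / J (Suc n)\<close> comes
  from \<open>B\<close>.\<close>

definition lifts :: "nat \<Rightarrow> ('x \<Rightarrow> complex) \<Rightarrow> bool" where
  "lifts n g \<longleftrightarrow> g \<in> J n \<and> (\<exists>b\<in>B. (\<lambda>x. g x - b x) \<in> J (Suc n))"

lemma lifts_mult:
  assumes "lifts m g" "lifts n h"
  shows "lifts (m + n) (\<lambda>x. g x * h x)"
proof -
  obtain b c where b: "b \<in> B" "(\<lambda>x. g x - b x) \<in> J (Suc m)" and c: "c \<in> B" "(\<lambda>x. h x - c x) \<in> J (Suc n)"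
    using assms by (auto simp: lifts_def)
  have g: "g \<in> J m" and h: "h \<in> J n"
    using assms by (auto simp: lifts_def)
  \<comment> \<open>\<open>b\<close> differs from \<open>g\<close> only in higher degree, so it
    inherits degree \<open>m\<close>; this makes \<open>b * (h - c)\<close> small enough.\<close>
  have "(\<lambda>x. g x - (g x - b x)) \<in> J m"
    by (intro J_diff g J_mono[OF b(2)]) simp
  then have bm: "b \<in> J m"
    by simp
  have "(\<lambda>x. (g x - b x) * h x + b x * (h x - c x)) \<in> J (Suc (m + n))"
    by (intro J_add J_mult_le[OF b(2) h] J_mult_le[OF bm c(2)]) auto
  also have "(\<lambda>x. (g x - b x) * h x + b x * (h x - c x)) = (\<lambda>x. g x * h x - b x * c x)"
    by (simp add: algebra_simps)
  finally show ?thesis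
    using J_mult[OF g h] B_mult[OF b(1) c(1)] by (auto simp: lifts_def)
qed

lemma lifts_J_Suc: "g \<in> J (Suc n) \<Longrightarrow> lifts n g"
  using B_const[OF zero_closed] J_mono[of g "Suc n" n] by (force simp: lifts_def)

lemma lifts_const: "c \<in> I n \<Longrightarrow> lifts n (\<lambda>_. c)"
  using J_const[of c n] B_const[of c] J_zero I_mono[of c n 0] by (force simp: lifts_def I_0)

lemma lifts_coordinate:
  assumes "u \<in> U"
  shows "lifts 1 (\<lambda>x. \<pi> * of_int (N u x))"
proof -
  obtain w where w: "(\<lambda>x. F w x - 1 - \<pi> * of_int (N u x)) \<in> J 2"
    using F_coordinate[OF assms] by blast
  have b: "(\<lambda>x. F w x + - 1) \<in> B"
    by (intro B_add B_F B_const uminus_closed one_closed)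
  from J_uminus[OF w] have "(\<lambda>x. \<pi> * of_int (N u x) - (F w x + - 1)) \<in> J (Suc 1)"
    by (simp add: algebra_simps numeral_2_eq_2)
  then show ?thesis
    using J_coordinate[OF assms I_pi] b by (auto simp: lifts_def)
qed

lemma lifts_power: "lifts n g \<Longrightarrow> lifts (k * n) (\<lambda>x. g x ^ k)"
  by (induction k) (auto intro: lifts_mult lifts_const[of 1 0] I_one)

lemma lifts_prod:
  "(\<And>i. i \<in> A \<Longrightarrow> lifts (n i) (g i)) \<Longrightarrow> lifts (sum n A) (\<lambda>x. \<Prod>i\<in>A. g i x)"
  by (induction A rule: infinite_finite_induct) (auto intro: lifts_mult lifts_const[of 1 0] I_one)

text \<open>A monomial is a scalar times a product of functions \<open>\<pi> * N u\<close>, each of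
  which lifts.\<close>

lemma lifts_J: "g \<in> J n \<Longrightarrow> lifts n g"
proof (induction rule: J.induct)
  case (J_monomial c e m)
  \<comment> \<open>The scalar left once every coordinate factor has taken one
    \<open>\<pi>\<close>.\<close>
  define d where "d = c / \<pi> ^ sum m U"
  have d: "d \<in> I (e - sum m U)"
    using J_monomial pi_nonzero by (simp add: I_def d_def flip: power_add)
  have "lifts (e - sum m U + sum m U) (\<lambda>x. d * (\<Prod>u\<in>U. (\<pi> * of_int (N u x)) ^ m u))"
    using lifts_power[OF lifts_coordinate] by (intro lifts_mult lifts_const d lifts_prod) force
  moreover have "(\<lambda>x. d * (\<Prod>u\<in>U. (\<pi> * of_int (N u x)) ^ m u)) = (\<lambda>x. c * (\<Prod>u\<in>U. of_int (N u x) ^ m u))"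
    by (simp add: d_def power_mult_distrib prod.distrib pi_nonzero flip: power_sum)
  ultimately have l: "lifts e (\<lambda>x. c * (\<Prod>u\<in>U. of_int (N u x) ^ m u))"
    using J_monomial by simp
  show ?case
  proof (cases "e = n")
    \<comment> \<open>A monomial with \<open>e > n\<close> already lies in \<open>J (Suc n)\<close>
      and is approximated by 0.\<close>
    case False
    with J_monomial have "Suc n \<le> e"
      by simp
    then show ?thesis
      using l J_mono by (intro lifts_J_Suc) (auto simp: lifts_def)
  qed (use l in simp)
next
  case (J_add g h)
  then obtain b c where "b \<in> B" "(\<lambda>x. g x - b x) \<in> J (Suc n)" "c \<in> B" "(\<lambda>x. h x - c x) \<in> J (Suc n)"
    by (auto simp: lifts_def)
  then have "(\<lambda>x. b x + c x) \<in> B" "(\<lambda>x. (g x - b x) + (h x - c x)) \<in> J (Suc n)"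
    by (auto intro: B_add J.J_add)
  then show ?case
    using J_add.hyps by (auto simp: lifts_def algebra_simps intro: J.J_add intro!: bexI[of _ "\<lambda>x. b x + c x"])
qed

text \<open>Successive approximation: the error of each stage is lifted in turn. Any finite accuracy
  is reached, which is enough for comparing sums.\<close>

lemma J_0_approximation: "g \<in> J 0 \<Longrightarrow> \<exists>b\<in>B. (\<lambda>x. g x - b x) \<in> J k"
proof (induction k)
  case 0
  then show ?case
    using B_const[OF zero_closed] by force
next
  case (Suc k)
  then obtain b where b: "b \<in> B" "(\<lambda>x. g x - b x) \<in> J k"
    by blast
  then obtain c where "c \<in> B" "(\<lambda>x. (g x - b x) - c x) \<in> J (Suc k)"
    using lifts_J[OF b(2)] by (auto simp: lifts_def)
  then show ?case
    using B_add[OF b(1), of c] by (force simp: algebra_simps)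
qed

text \<open>Otherwise every member of \<open>B\<close> has its sum in
  \<open>I (Suc (2 * card U))\<close>, and so has the top function, which \<open>B\<close>
  approximates up to \<open>J (Suc (2 * card U))\<close>. This contradicts
  \<open>sum_top\<close>.\<close>

lemma ex_sum_F_nonmember: "\<exists>w. (\<Sum>x\<in>UNIV. F w x) \<notin> I (Suc (2 * card U))"
proof (rule ccontr)
  assume *: "\<nexists>w. (\<Sum>x\<in>UNIV. F w x) \<notin> I (Suc (2 * card U))"
  have sum_B: "(\<Sum>x\<in>UNIV. b x) \<in> I (Suc (2 * card U))" if "b \<in> B" for b
    using that
  proof (induction rule: B.induct)
    case (B_scale c g)
    then show ?case
      by (simp add: I_mult0 flip: sum_distrib_left)
  qed (use * in \<open>auto intro: sum_pi_J I_add simp: sum.distrib\<close>)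
  let ?g = "\<lambda>x. \<Prod>u\<in>U. (\<pi> * of_int (N u x)) ^ 2"
  obtain b where b: "b \<in> B" "(\<lambda>x. ?g x - b x) \<in> J (Suc (2 * card U))"
    using J_0_approximation[OF J_top] by blast
  have "(\<Sum>x\<in>UNIV. ?g x - b x) + (\<Sum>x\<in>UNIV. b x) \<in> I (Suc (2 * card U))"
    using sum_J[OF b(2)] by (intro I_add sum_B[OF b(1)]) simp
  then have "\<pi> ^ (2 * card U) * 2 ^ card U \<in> I (Suc (2 * card U))"
    by (simp add: sum_top flip: sum.distrib)
  then show False
    using two_power_nonmember by blast
qed

end

section \<open>Characters of the Witt vectors\<close>

locale witt_character = uniformized_ring R for R :: "complex set" +
  fixes \<xi> :: "'a::{field,finite} \<times> 'a \<Rightarrow> complex" and f :: nat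
  assumes card: "CARD('a) = 3 ^ f"
    and hom: "\<xi> \<in> hom witt2 (units_of complex_ring)"
    and nontrivial: "\<exists>b. \<xi> (0, b) \<noteq> 1"
begin

lemma three_eq_0: "(3::'a) = 0"
proof -
  have "of_nat CARD('a) = (0::'a)"
    using CHAR_dvd_CARD[where 'a='a] by (simp add: of_nat_eq_0_iff_char_dvd)
  then show ?thesis
    by (simp add: card)
qed

lemma cube_add: "(x + y) ^ 3 = x ^ 3 + (y :: 'a) ^ 3"
proof -
  have "(x + y) ^ 3 = x ^ 3 + y ^ 3 + 3 * (x * y * (x + y))"
    by Groebner_Basis.algebra
  then show ?thesis
    by (simp add: three_eq_0)
qed

lemma cube_sum: "(\<Sum>i\<in>A. g i) ^ 3 = (\<Sum>i\<in>A. (g i :: 'a) ^ 3)"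
  by (induction A rule: infinite_finite_induct) (simp_all add: cube_add)

lemma power_9: "\<xi> w ^ 9 = 1"
  using card hom by (rule witt2_character_power_9)

lemma nonzero: "\<xi> w \<noteq> 0"
  using power_9[of w] by (metis power_0_left zero_neq_numeral zero_neq_one)

lemma \<xi>_mult: "\<xi> (a + a', b + b' - a * a' * (a + a')) = \<xi> (a, b) * \<xi> (a', b')"
  using hom_mult[OF hom, of "(a, b)" "(a', b')"] by (simp add: units_of_mult ring_of_type_algebra_def)

lemma \<xi>_zero: "\<xi> (0, 0) = 1"
  using \<xi>_mult[of 0 0 0 0] nonzero by simp

lemma \<psi>_add: "\<xi> (0, b + b') = \<xi> (0, b) * \<xi> (0, b')"
  using \<xi>_mult[of 0 0 b b'] by simp

lemma \<psi>_uminus: "\<xi> (0, - b) = inverse (\<xi> (0, b))"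
  using \<psi>_add[of b "- b"] by (intro inverse_unique[symmetric]) (simp add: \<xi>_zero)

lemma \<psi>_cube: "\<xi> (0, b) ^ 3 = 1"
proof -
  have "b + b + b = 3 * b"
    by simp
  then have "\<xi> (0, b + b + b) = 1"
    by (simp only: three_eq_0 \<xi>_zero mult_zero_left)
  then show ?thesis
    by (simp only: \<psi>_add power3_eq_cube)
qed

text \<open>The group law gives \<open>(x, 0) + (y, 0) = (x + y, - x y (x + y))\<close>; the second
  component becomes a separate factor.\<close>

lemma \<xi>_add: "\<xi> (x + y, 0) = \<xi> (x, 0) * \<xi> (y, 0) * \<xi> (0, x * y * (x + y))"
  using \<xi>_mult[of "x + y" 0 "- (x * y * (x + y))" "x * y * (x + y)"] \<xi>_mult[of x y 0 0] by simp

lemma \<xi>_uminus: "\<xi> (- x, 0) = inverse (\<xi> (x, 0))"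
  using \<xi>_add[of x "- x"] by (intro inverse_unique[symmetric]) (simp add: \<xi>_zero)

text \<open>In characteristic 3, multiplication by 3 on Witt vectors is Frobenius followed by the
  shift, \<open>(x, 0) \<mapsto> (0, x ^ 3)\<close>.\<close>

lemma \<xi>_cube: "\<xi> (x, 0) ^ 3 = \<xi> (0, x ^ 3)"
proof -
  have "x + x + x = 3 * x"
    by simp
  then have *: "x + x + x = 0"
    by (simp only: three_eq_0 mult_zero_left)
  have "\<xi> (x, 0) ^ 3 = \<xi> (x + x + x, - (x * x * (x + x)) - (x + x) * x * (x + x + x))"
    using \<xi>_mult[of x x 0 0] \<xi>_mult[of "x + x" x "- (x * x * (x + x))" 0]
    by (simp add: power3_eq_cube)
  also have "- (x * x * (x + x)) = x ^ 3 - 3 * x ^ 3"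
    by (simp add: power3_eq_cube)
  finally show ?thesis
    unfolding * by (simp add: three_eq_0)
qed

text \<open>The choice of representatives matters: \<open>(- x, 0)\<close> is the inverse of
  \<open>(x, 0)\<close>, but \<open>x \<mapsto> \<xi> (x, 0)\<close> is not additive.\<close>

lemma of_int_ternary:
  "n \<in> {-1, 0, 1} \<Longrightarrow> \<xi> (0, of_int n * c) = \<xi> (0, c) powi n"
  "n \<in> {-1, 0, 1} \<Longrightarrow> \<xi> (of_int n * c, 0) = \<xi> (c, 0) powi n"
  by (auto simp: \<xi>_zero \<xi>_uminus \<psi>_uminus power_int_minus)

text \<open>The class modulo 3 of the discrete logarithm of \<open>\<xi> (x, 0)\<close>, represented in \<open>{-1, 0, 1}\<close>.\<close>

definition l :: "'a \<Rightarrow> int" where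
  "l x = (int (SOME r. \<xi> (x, 0) = zeta9 ^ r) + 1) mod 3 - 1"

lemma ternary_mod_3: "(n + 1) mod 3 - 1 \<in> {-1, 0, 1 :: int}"
proof -
  have "(n + 1) mod 3 = 0 \<or> (n + 1) mod 3 = 1 \<or> (n + 1) mod 3 = 2"
    by presburger
  then show ?thesis
    by auto
qed

lemma l_range: "l x \<in> {-1, 0, 1}"
  unfolding l_def by (rule ternary_mod_3)

lemma ternary_cong_eq: "m \<in> {-1, 0, 1} \<Longrightarrow> n \<in> {-1, 0, 1} \<Longrightarrow> [m = n] (mod 3) \<Longrightarrow> m = (n :: int)"
  by (auto simp: cong_def)

lemma l_spec:
  obtains r where "\<xi> (x, 0) = zeta9 ^ r" "[int r = l x] (mod 3)"
proof
  let ?r = "SOME r. \<xi> (x, 0) = zeta9 ^ r"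
  show "\<xi> (x, 0) = zeta9 ^ ?r"
    using root_of_unity_9[OF power_9] by (rule someI_ex)
  have "int ?r mod 3 = ((int ?r + 1) mod 3 - 1) mod 3"
    by presburger
  then show "[int ?r = l x] (mod 3)"
    by (simp add: l_def cong_def)
qed

text \<open>Cubing removes the correction factor in \<open>\<xi>_add\<close>, a cube root of unity,
  and exponents of \<open>zeta9 ^ 3\<close> are determined modulo 3.\<close>

lemma l_add: "[l (x + y) = l x + l y] (mod 3)"
proof -
  obtain r where r: "\<xi> (x, 0) = zeta9 ^ r" "[int r = l x] (mod 3)"
    by (rule l_spec)
  obtain s where s: "\<xi> (y, 0) = zeta9 ^ s" "[int s = l y] (mod 3)"
    by (rule l_spec)
  obtain t where t: "\<xi> (x + y, 0) = zeta9 ^ t" "[int t = l (x + y)] (mod 3)"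
    by (rule l_spec)
  have "\<xi> (x + y, 0) ^ 3 = \<xi> (x, 0) ^ 3 * \<xi> (y, 0) ^ 3"
    by (simp add: \<xi>_add power_mult_distrib \<psi>_cube)
  then have "zeta9 ^ (t * 3) = zeta9 ^ (r * 3) * zeta9 ^ (s * 3)"
    by (simp add: r s t flip: power_mult)
  \<comment> \<open>\<open>2 * t\<close> stands for \<open>- t\<close> modulo 3, so that exponents
    stay natural numbers.\<close>
  then have "zeta9 ^ ((r + s + 2 * t) * 3) = zeta9 ^ (t * 3) * zeta9 ^ (2 * t * 3)"
    by (simp add: distrib_right power_add)
  also have "\<dots> = zeta9 ^ (3 * t * 3)"
    by (simp flip: power_add)
  also have "\<dots> = 1"
    by (simp only: zeta9_power_3_eq_1 dvd_triv_left)
  finally have "zeta9 ^ ((r + s + 2 * t) * 3) = 1" .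
  then have "3 dvd r + s + 2 * t"
    by (simp only: zeta9_power_3_eq_1)
  then have "[int t = int r + int s] (mod 3)"
    unfolding cong_def by presburger
  then show ?thesis
    using r(2) s(2) t(2) by (meson cong_add cong_sym cong_trans)
qed

lemma l_zero: "l 0 = 0"
  using l_add[of 0 0] l_range[of 0] by (auto simp: cong_def)

lemma l_uminus: "l (- x) = - l x"
  using l_add[of x "- x"] l_range[of x] l_range[of "- x"] by (auto simp: cong_def l_zero)

lemma l_sum: "[l (\<Sum>i\<in>A. g i) = (\<Sum>i\<in>A. l (g i))] (mod 3)"
  by (induction A rule: infinite_finite_induct) (auto simp: l_zero intro: cong_trans[OF l_add] cong_add[OF cong_refl])

lemma l_ternary: "n \<in> {-1, 0, 1} \<Longrightarrow> l (of_int n * x) = n * l x"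
  by (auto simp: l_zero l_uminus)

text \<open>Cubing is bijective on the field, so \<xi> is nontrivial at some
  \<open>(0, y ^ 3)\<close>, where its value is the cube of \<open>\<xi> (y, 0)\<close>.\<close>

lemma l_nontrivial: "\<exists>x. l x \<noteq> 0"
proof -
  have "inj (\<lambda>x::'a. x ^ 3)"
  proof (rule injI)
    fix x y :: 'a
    assume "x ^ 3 = y ^ 3"
    then have "(x - y) ^ 3 = 0"
      using cube_add[of "x - y" y] by simp
    then show "x = y"
      by simp
  qed
  then have "surj (\<lambda>x::'a. x ^ 3)"
    by (simp add: finite_UNIV_inj_surj)
  then obtain y where y: "\<xi> (0, y ^ 3) \<noteq> 1"
    using nontrivial by (metis surjD)
  obtain r where r: "\<xi> (y, 0) = zeta9 ^ r" "[int r = l y] (mod 3)"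
    by (rule l_spec)
  have "\<not> 3 dvd r"
    using y by (simp add: r zeta9_power_3_eq_1 flip: \<xi>_cube power_mult)
  then have "l y \<noteq> 0"
    using r(2) unfolding cong_def by presburger
  then show ?thesis ..
qed

text \<open>The set \<open>U\<close> is a separating set of minimal size; dropping \<open>u\<close> from it yields \<open>e u\<close> up to sign.\<close>

lemma ex_dual_basis:
  obtains U e where "finite U" "\<And>u v. u \<in> U \<Longrightarrow> v \<in> U \<Longrightarrow> l (v * e u) = (if u = v then 1 else 0)"
    "\<And>x. (\<And>u. u \<in> U \<Longrightarrow> l (u * x) = 0) \<Longrightarrow> x = 0"
proof -
  define sep where "sep U \<longleftrightarrow> (\<forall>x. (\<forall>u\<in>U. l (u * x) = 0) \<longrightarrow> x = 0)" for U
  have "sep UNIV"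
    unfolding sep_def
  proof (intro allI impI)
    fix x
    assume *: "\<forall>u\<in>UNIV. l (u * x) = 0"
    obtain y where "l y \<noteq> 0"
      using l_nontrivial by blast
    \<comment> \<open>For \<open>x \<noteq> 0\<close> the multiplier \<open>y / x\<close> carries
      \<open>x\<close> to \<open>y\<close>, where \<open>l\<close> does not vanish.\<close>
    then show "x = 0"
      using *[rule_format, of "y / x"] by (cases "x = 0") auto
  qed
  then obtain U where U: "sep U" "\<And>V. sep V \<Longrightarrow> card U \<le> card V"
    using ex_has_least_nat[of sep UNIV card] by auto
  have "\<exists>x. \<forall>v\<in>U. l (v * x) = (if u = v then 1 else 0)" if "u \<in> U" for u
  proof -
    have "card (U - {u}) < card U"
      using that by (intro psubset_card_mono) auto
    then have "\<not> sep (U - {u})"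
      using U(2)[of "U - {u}"] by auto
    then obtain x where x: "\<And>v. v \<in> U \<Longrightarrow> v \<noteq> u \<Longrightarrow> l (v * x) = 0" "x \<noteq> 0"
      unfolding sep_def by auto
    with U(1) have "l (u * x) \<noteq> 0"
      unfolding sep_def by metis
    then have "l (u * x) = 1 \<or> l (u * (- x)) = 1"
      using l_range[of "u * x"] by (auto simp: l_uminus)
    moreover have "l (v * (- x)) = 0" if "v \<in> U" "v \<noteq> u" for v
      using x(1)[OF that] by (simp add: l_uminus)
    ultimately show ?thesis
      using x(1) by (metis (full_types))
  qed
  then obtain e where "\<And>u v. u \<in> U \<Longrightarrow> v \<in> U \<Longrightarrow> l (v * e u) = (if u = v then 1 else 0)"
    by metis
  then show thesis
    using that[of U e] U(1) unfolding sep_def by auto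
qed

end

section \<open>Coordinates in the dual basis\<close>

locale witt_character_basis = witt_character R \<xi> f
  for R :: "complex set" and \<xi> :: "'a::{field,finite} \<times> 'a \<Rightarrow> complex" and f :: nat +
  fixes U :: "'a set" and e :: "'a \<Rightarrow> 'a"
  assumes finite_basis: "finite U"
    and dual: "u \<in> U \<Longrightarrow> v \<in> U \<Longrightarrow> l (v * e u) = (if u = v then 1 else 0)"
    and separating: "(\<And>u. u \<in> U \<Longrightarrow> l (u * x) = 0) \<Longrightarrow> x = 0"
begin

abbreviation N :: "'a \<Rightarrow> 'a \<Rightarrow> int" where
  "N u x \<equiv> l (u * x)"

lemma N_combination:
  assumes "v \<in> U" "\<And>u. u \<in> U \<Longrightarrow> n u \<in> {-1, 0, 1}"
  shows "N v (\<Sum>u\<in>U. of_int (n u) * e u) = n v"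
proof (rule ternary_cong_eq[OF l_range])
  have "v * (\<Sum>u\<in>U. of_int (n u) * e u) = (\<Sum>u\<in>U. of_int (n u) * (v * e u))"
    by (simp add: sum_distrib_left mult_ac)
  moreover have "[l (\<Sum>u\<in>U. of_int (n u) * (v * e u)) = (\<Sum>u\<in>U. l (of_int (n u) * (v * e u)))] (mod 3)"
    by (rule l_sum)
  moreover have "(\<Sum>u\<in>U. l (of_int (n u) * (v * e u))) = (\<Sum>u\<in>U. if u = v then n u else 0)"
    using assms by (intro sum.cong refl) (simp add: l_ternary dual)
  moreover have "\<dots> = n v"
    using assms(1) finite_basis by simp
  ultimately show "[N v (\<Sum>u\<in>U. of_int (n u) * e u) = n v] (mod 3)"
    by simp
qed (use assms in blast)

text \<open>Both sides have the same coordinates, and \<open>U\<close> separates points.\<close>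

lemma expansion: "(\<Sum>u\<in>U. of_int (N u x) * e u) = x"
proof -
  let ?y = "\<Sum>u\<in>U. of_int (N u x) * e u"
  have "?y - x = 0"
  proof (rule separating)
    fix v assume v: "v \<in> U"
    have "N v ?y = N v x"
      using v l_range by (rule N_combination)
    then have "[l (v * ?y + (- (v * x))) = 0] (mod 3)"
      using l_add[of "v * ?y" "- (v * x)"] by (simp add: l_uminus)
    then show "l (v * (?y - x)) = 0"
      using ternary_cong_eq[OF l_range, of 0] by (simp add: algebra_simps)
  qed
  then show ?thesis
    by simp
qed

lemma bij_coordinates: "bij_betw (\<lambda>x. \<lambda>u\<in>U. N u x) UNIV (PiE U (\<lambda>_. {-1, 0, 1}))"
proof (rule bij_betwI[where g = "\<lambda>n. \<Sum>u\<in>U. of_int (n u) * e u"])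
  show "(\<lambda>x. \<lambda>u\<in>U. N u x) \<in> UNIV \<rightarrow> PiE U (\<lambda>_. {-1, 0, 1})"
    using l_range by auto
  show "(\<Sum>u\<in>U. of_int ((\<lambda>u\<in>U. N u x) u) * e u) = x" for x
    using expansion[of x] by simp
  fix n :: "'a \<Rightarrow> int"
  assume n: "n \<in> PiE U (\<lambda>_. {-1, 0, 1})"
  show "(\<lambda>u\<in>U. N u (\<Sum>u\<in>U. of_int (n u) * e u)) = n"
  proof (rule extensionalityI)
    fix u assume u: "u \<in> U"
    have "N u (\<Sum>u\<in>U. of_int (n u) * e u) = n u"
      using u by (rule N_combination) (use n in blast)
    then show "(\<lambda>u\<in>U. N u (\<Sum>u\<in>U. of_int (n u) * e u)) u = n u"
      using u by simp
  qed (use n in \<open>auto simp: PiE_def\<close>)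
qed simp

lemma card_basis: "card U = f"
proof -
  have "CARD('a) = card (PiE U (\<lambda>_. {-1, 0, 1 :: int}))"
    using bij_betw_same_card[OF bij_coordinates] .
  then show ?thesis
    using card finite_basis power_inject_exp[of "3::nat" f "card U"] by (simp add: card_PiE eval_nat_numeral)
qed

end

sublocale witt_character_basis \<subseteq> ternary_coordinates R U N
  using finite_basis l_range bij_coordinates by unfold_locales auto

section \<open>Degrees of the character values in the coordinates\<close>

context witt_character_basis
begin

text \<open>Interpolation gives \<open>a * n + b * n ^ 2\<close> with \<open>a\<close> in
  \<open>I k\<close> and \<open>b\<close> in \<open>I (2 * k)\<close>. As \<open>n\<close> has
  weight \<open>j\<close>, the slack \<open>k - j \<ge> s\<close> allows division by
  \<open>\<pi> ^ s\<close>.\<close>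

lemma ternary_power_J:
  assumes z: "z ^ 9 = 1" "z - 1 \<in> I k"
    and n: "\<And>x. n x \<in> {-1, 0, 1}"
    and J: "(\<lambda>x. \<pi> ^ j * of_int (n x)) \<in> J j" "s + j \<le> k"
  shows "(\<lambda>x. (z powi n x - 1) / \<pi> ^ s) \<in> J (k - s)"
proof -
  obtain a b where a: "a \<in> I k" and b: "b \<in> I (2 * k)"
    and ab: "\<And>n. n \<in> {-1, 0, 1} \<Longrightarrow> z powi n = 1 + a * of_int n + b * of_int n ^ 2"
    using root_of_unity_interpolation[OF z] by metis
  have I: "c / \<pi> ^ s \<in> I (m - s)" if "c \<in> I m" "s \<le> m" for c m
    using that by (simp add: I_def pi_nonzero flip: power_add)
  have "(\<lambda>x. \<pi> ^ (j + j) * (of_int (n x) * of_int (n x))) \<in> J (j + j)"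
    using J_mult[OF J(1) J(1)] by (simp add: power_add mult_ac)
  from J_of_pi_power[OF I[OF b] this]
  have "(\<lambda>x. b / \<pi> ^ s * (of_int (n x) * of_int (n x))) \<in> J (2 * k - s)"
    using J(2) by simp
  then have 2: "(\<lambda>x. b / \<pi> ^ s * (of_int (n x) * of_int (n x))) \<in> J (k - s)"
    by (rule J_mono) simp
  from J_of_pi_power[OF I[OF a] J(1)]
  have "(\<lambda>x. a / \<pi> ^ s * of_int (n x)) \<in> J (k - s)"
    using J(2) by simp
  from J_add[OF this 2]
  have "(\<lambda>x. a / \<pi> ^ s * of_int (n x) + b / \<pi> ^ s * (of_int (n x) * of_int (n x))) \<in> J (k - s)" .
  then show ?thesis
    by (simp add: ab[OF n] power2_eq_square add_divide_distrib)
qed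

lemma \<psi>_ternary_J:
  assumes n: "\<And>x. n x \<in> {-1, 0, 1}" "(\<lambda>x. \<pi> ^ 3 * of_int (n x)) \<in> J 3"
  shows "(\<lambda>x. \<xi> (0, of_int (n x) * c) - 1) \<in> J 3"
  using ternary_power_J[OF power_9 I_cube_root[OF \<psi>_cube[of c]] n, where s = 0]
  by (simp add: of_int_ternary(1)[OF n(1)])

text \<open>The values are 1 modulo \<open>\<pi> ^ 3\<close>, while a single coordinate uses up only
  one \<open>\<pi>\<close>, so another one can be divided out.\<close>

lemma \<psi>_coordinate_pi_J:
  assumes "u \<in> U"
  shows "(\<lambda>x. \<xi> (0, of_int (N u x) * c) - 1) \<in> pi_J"
proof -
  have "(\<lambda>x. \<pi> ^ 1 * of_int (N u x)) \<in> J 1"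
    using J_coordinate[OF assms I_pi] by simp
  from ternary_power_J[OF power_9 I_cube_root[OF \<psi>_cube[of c]] l_range this, where s = 1]
  have "(\<lambda>x. (\<xi> (0, c) powi N u x - 1) / \<pi>) \<in> J 0"
    by (intro J_mono[of _ 2 0]) simp_all
  then show ?thesis
    by (simp add: pi_J_def of_int_ternary(1)[OF l_range])
qed

lemma J_unit_mult:
  assumes "(\<lambda>x. g x - 1) \<in> J k" "(\<lambda>x. h x - 1) \<in> J k"
  shows "(\<lambda>x. g x * h x - 1) \<in> J k"
proof -
  have "(\<lambda>x. (g x - 1) * (h x - 1) + (g x - 1) + (h x - 1)) \<in> J k"
    using assms by (intro J_add J_mult_le[OF assms]) auto
  then show ?thesis
    by (simp add: algebra_simps)
qed

lemma \<psi>_sum_J: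
  "(\<And>i. i \<in> A \<Longrightarrow> (\<lambda>x. \<xi> (0, h i x) - 1) \<in> J k) \<Longrightarrow> (\<lambda>x. \<xi> (0, \<Sum>i\<in>A. h i x) - 1) \<in> J k"
  by (induction A rule: infinite_finite_induct) (simp_all add: \<xi>_zero J_zero \<psi>_add J_unit_mult)

lemma \<psi>_sum_pi_J:
  "(\<And>i. i \<in> A \<Longrightarrow> (\<lambda>x. \<xi> (0, h i x) - 1) \<in> pi_J) \<Longrightarrow> (\<lambda>x. \<xi> (0, \<Sum>i\<in>A. h i x) - 1) \<in> pi_J"
proof (induction A rule: infinite_finite_induct)
  case (insert i A)
  have "(\<lambda>x. (\<xi> (0, h i x) - 1) * (\<xi> (0, \<Sum>i\<in>A. h i x) - 1) + (\<xi> (0, h i x) - 1) + (\<xi> (0, \<Sum>i\<in>A. h i x) - 1)) \<in> pi_J"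
    using insert by (intro pi_J_add pi_J_mult pi_J_subset) auto
  then show ?case
    using insert.hyps by (simp add: \<psi>_add algebra_simps)
qed (simp_all add: \<xi>_zero pi_J_zero)

text \<open>A product of three coordinates is again ternary; its weight 3 is exactly covered by cube
  roots of unity being 1 modulo \<open>\<pi> ^ 3\<close>.\<close>

lemma triple_product_J:
  assumes "a \<in> U" "b \<in> U" "c \<in> U"
  shows "(\<lambda>x. \<xi> (0, of_int (N a x * N b x * N c x) * k) - 1) \<in> J 3"
proof (rule \<psi>_ternary_J)
  show "N a x * N b x * N c x \<in> {-1, 0, 1}" for x
    using l_range[of "a * x"] l_range[of "b * x"] l_range[of "c * x"] by auto
  have "(\<lambda>x. (\<pi> * of_int (N a x)) * (\<pi> * of_int (N b x)) * (\<pi> * of_int (N c x))) \<in> J (1 + 1 + 1)"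
    by (intro J_mult J_coordinate I_pi assms)
  then show "(\<lambda>x. \<pi> ^ 3 * of_int (N a x * N b x * N c x)) \<in> J 3"
    by (simp add: power3_eq_cube mult_ac numeral_3_eq_3)
qed

text \<open>In the interpolation for \<open>\<xi> (c, 0)\<close> the linear coefficient is
  \<open>l c * \<pi>\<close> modulo \<open>\<pi> ^ 2\<close>, and the quadratic term has degree
  2.\<close>

lemma \<xi>_ternary_J:
  assumes "u \<in> U"
  shows "(\<lambda>x. \<xi> (of_int (N u x) * c, 0) - 1 - \<pi> * of_int (l c * N u x)) \<in> J 2"
proof -
  obtain r where r: "\<xi> (c, 0) = zeta9 ^ r" "[int r = l c] (mod 3)"
    by (rule l_spec)
  let ?z = "\<xi> (c, 0)"
  have z: "?z - 1 - of_int (l c) * \<pi> \<in> I 2"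
    using I_pi_multiple[OF r(2)] r(1) by simp
  have "of_int (l c) * \<pi> \<in> I 1"
    using I_mult[OF I_of_int I_pi] by simp
  then have "?z - 1 \<in> I 1"
    using I_add[OF I_mono[OF z, of 1]] by fastforce
  from root_of_unity_interpolation[OF power_9 this, unfolded mult_1_right]
  obtain a b where a: "a - (?z - 1) \<in> I 2" and b: "b \<in> I 2"
    and ab: "\<And>n. n \<in> {-1, 0, 1} \<Longrightarrow> ?z powi n = 1 + a * of_int n + b * of_int n ^ 2"
    by blast
  have N: "(\<lambda>x. \<pi> ^ 1 * of_int (N u x)) \<in> J 1"
    using J_coordinate[OF assms I_pi] by simp
  have "(a - (?z - 1)) + (?z - 1 - of_int (l c) * \<pi>) \<in> I 2"
    using a z by (rule I_add)
  then have "a - of_int (l c) * \<pi> \<in> I 2"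
    by simp
  from J_of_pi_power[OF this N] have 1: "(\<lambda>x. (a - of_int (l c) * \<pi>) * of_int (N u x)) \<in> J 2"
    by simp
  have "(\<lambda>x. \<pi> ^ 2 * of_int (N u x) ^ 2) \<in> J 2"
    using J_mult[OF N N] by (simp add: power2_eq_square mult_ac numeral_2_eq_2)
  from J_of_pi_power[OF b this] have 2: "(\<lambda>x. b * of_int (N u x) ^ 2) \<in> J 2"
    by simp
  show ?thesis
    using J_add[OF 1 2] by (simp only: of_int_ternary(2)[OF l_range] ab[OF l_range]) (simp add: algebra_simps)
qed

text \<open>
  The correction terms in the group law are cubic in the coordinates, and the values of \<open>\<xi>\<close> on
  \<open>{0} \<times> F\<^sub>q\<close> are congruent to 1 modulo \<open>\<pi>\<^sup>3\<close>.
\<close>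

lemma \<xi>_combination_J:
  assumes "A \<subseteq> U"
  shows "(\<lambda>x. \<xi> (\<Sum>u\<in>A. of_int (N u x) * w u, 0) - 1 - \<pi> * of_int (\<Sum>u\<in>A. l (w u) * N u x)) \<in> J 2"
  using finite_subset[OF assms finite_U] assms
proof (induction A rule: finite_induct)
  case (insert v A)
  \<comment> \<open>\<open>s\<close> is the sum treated so far and \<open>t\<close> the new term;
    \<open>p\<close> and \<open>q\<close> are their linear parts.\<close>
  define s where "s x = (\<Sum>u\<in>A. of_int (N u x) * w u)" for x
  define t where "t x = of_int (N v x) * w v" for x
  define p where "p x = \<pi> * of_int (\<Sum>u\<in>A. l (w u) * N u x)" for x
  define q where "q x = \<pi> * of_int (l (w v) * N v x)" for x
  have v: "v \<in> U" and A: "A \<subseteq> U"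
    using insert.prems by auto
  have "s x * t x * (s x + t x) =
      (\<Sum>a\<in>A. \<Sum>b\<in>A. of_int (N a x * N b x * N v x) * (w a * w b * w v)) +
      (\<Sum>a\<in>A. of_int (N a x * N v x * N v x) * (w a * w v * w v))" for x
    unfolding s_def t_def
    by (simp add: distrib_left sum_distrib_left sum_distrib_right sum.distrib mult_ac)
  then have E: "(\<lambda>x. \<xi> (0, s x * t x * (s x + t x)) - 1) \<in> J 3"
    using A v by (auto simp only: \<psi>_add intro!: J_unit_mult \<psi>_sum_J triple_product_J)
  have 1: "(\<lambda>x. \<xi> (s x, 0) - 1 - p x) \<in> J 2"
    using insert.IH A by (simp add: s_def p_def)
  have 2: "(\<lambda>x. \<xi> (t x, 0) - 1 - q x) \<in> J 2"
    using \<xi>_ternary_J[OF v] by (simp add: t_def q_def)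
  have coord: "(\<lambda>x. \<pi> * of_int (l (w u) * N u x)) \<in> J 1" if "u \<in> U" for u
    using J_coordinate[OF that, of "\<pi> * of_int (l (w u))"] I_mult[OF I_pi I_of_int] by (simp add: mult_ac)
  have "p = (\<lambda>x. \<Sum>u\<in>A. \<pi> * of_int (l (w u) * N u x))"
    by (simp add: p_def fun_eq_iff sum_distrib_left)
  then have p: "p \<in> J 1"
    using coord A by (auto intro!: J_sum simp del: of_int_mult)
  have "q = (\<lambda>x. \<pi> * of_int (l (w v) * N v x))"
    by (simp add: q_def fun_eq_iff)
  then have q: "q \<in> J 1"
    using coord[OF v] by simp
  have s1: "(\<lambda>x. \<xi> (s x, 0) - 1) \<in> J 1"
    using J_add[OF J_mono[OF 1, of 1] p] by simp
  have t1: "(\<lambda>x. \<xi> (t x, 0) - 1) \<in> J 1"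
    using J_add[OF J_mono[OF 2, of 1] q] by simp
  have "(\<lambda>x. \<xi> (s x, 0) * \<xi> (t x, 0) - 1) \<in> J 0"
    using J_mono[OF s1] J_mono[OF t1] by (intro J_unit_mult) auto
  from J_add[OF this J_one] have st: "(\<lambda>x. \<xi> (s x, 0) * \<xi> (t x, 0)) \<in> J 0"
    by simp
  \<comment> \<open>With \<open>G\<close>, \<open>H\<close>, \<open>E\<close> for the three values
    of \<xi>: \<open>G H E - 1 = (G - 1) + (H - 1) + (G - 1) (H - 1) + G H (E - 1)\<close>.\<close>
  have "(\<lambda>x. (\<xi> (s x, 0) - 1 - p x) + (\<xi> (t x, 0) - 1 - q x) + (\<xi> (s x, 0) - 1) * (\<xi> (t x, 0) - 1) +
      (\<xi> (s x, 0) * \<xi> (t x, 0)) * (\<xi> (0, s x * t x * (s x + t x)) - 1)) \<in> J 2"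
    by (intro J_add 1 2 J_mult_le[OF s1 t1] J_mult_le[OF st E]) auto
  also have "(\<lambda>x. (\<xi> (s x, 0) - 1 - p x) + (\<xi> (t x, 0) - 1 - q x) + (\<xi> (s x, 0) - 1) * (\<xi> (t x, 0) - 1) +
      (\<xi> (s x, 0) * \<xi> (t x, 0)) * (\<xi> (0, s x * t x * (s x + t x)) - 1)) =
      (\<lambda>x. \<xi> (s x + t x, 0) - 1 - (p x + q x))"
    by (simp add: \<xi>_add algebra_simps)
  finally show ?case
    using insert.hyps by (simp add: s_def t_def p_def q_def add_ac distrib_left)
qed (simp add: \<xi>_zero J_zero)

definition F :: "'a \<Rightarrow> 'a \<Rightarrow> complex" where
  "F w x = \<xi> (w * x, 0)"

lemma F_linear: "(\<lambda>x. F w x - 1 - \<pi> * of_int (\<Sum>u\<in>U. l (w * e u) * N u x)) \<in> J 2"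
proof -
  have "(\<Sum>u\<in>U. of_int (N u x) * (w * e u)) = w * x" for x
  proof -
    have "(\<Sum>u\<in>U. of_int (N u x) * (w * e u)) = w * (\<Sum>u\<in>U. of_int (N u x) * e u)"
      by (simp only: sum_distrib_left mult.left_commute)
    then show ?thesis
      by (simp only: expansion)
  qed
  then show ?thesis
    using \<xi>_combination_J[OF subset_refl, of "\<lambda>u. w * e u"] by (simp only: F_def)
qed

lemma F_mem_J: "F w \<in> J 0"
proof -
  have "(\<lambda>x. \<pi> * of_int (l (w * e u) * N u x)) \<in> J 0" if "u \<in> U" for u
    using J_mono[OF J_coordinate[OF that, of "\<pi> * of_int (l (w * e u))"], of 0] I_mult[OF I_pi I_of_int]
    by (simp add: mult_ac)
  then have "(\<lambda>x. \<pi> * of_int (\<Sum>u\<in>U. l (w * e u) * N u x)) \<in> J 0"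
    using J_sum[of U "\<lambda>u x. \<pi> * of_int (l (w * e u) * N u x)" 0] by (simp add: sum_distrib_left)
  from J_add[OF J_add[OF J_mono[OF F_linear[of w], of 0] this] J_one] show ?thesis
    by simp
qed

text \<open>Cubing is additive in characteristic 3 and fixes -1, 0, 1, so \<open>x ^ 3\<close> is
  linear in the coordinates of \<open>x\<close>, and each term has weight only 1.\<close>

lemma \<psi>_cubic_pi_J: "(\<lambda>x. \<xi> (0, c * x ^ 3) - 1) \<in> pi_J"
proof -
  have tern: "of_int n ^ 3 = (of_int n :: 'a)" if "n \<in> {-1, 0, 1}" for n
    using that by auto
  have eq: "(\<Sum>u\<in>U. of_int (N u x) * (c * e u ^ 3)) = c * x ^ 3" for x
  proof -
    have "c * x ^ 3 = c * (\<Sum>u\<in>U. of_int (N u x) * e u) ^ 3"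
      by (simp only: expansion)
    also have "\<dots> = (\<Sum>u\<in>U. c * (of_int (N u x) ^ 3 * e u ^ 3))"
      by (simp only: cube_sum sum_distrib_left power_mult_distrib)
    finally show ?thesis
      by (simp only: tern[OF l_range] mult.left_commute)
  qed
  have "(\<lambda>x. \<xi> (0, \<Sum>u\<in>U. of_int (N u x) * (c * e u ^ 3)) - 1) \<in> pi_J"
    by (intro \<psi>_sum_pi_J \<psi>_coordinate_pi_J)
  then show ?thesis
    unfolding eq .
qed

text \<open>The correction for \<open>v * x\<close> and \<open>w * x\<close> is a constant times
  \<open>x ^ 3\<close>.\<close>

lemma F_product: "(\<lambda>x. F v x * F w x - F (v + w) x) \<in> pi_J"
proof -
  define c where "c = v * w * (v + w)"
  have "F (v + w) x * (\<xi> (0, - c * x ^ 3) - 1) = F v x * F w x - F (v + w) x" for x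
  proof -
    have "v * x * (w * x) * (v * x + w * x) = c * x ^ 3"
      by (simp add: c_def power3_eq_cube distrib_left distrib_right mult_ac)
    then have "F (v + w) x = F v x * F w x * \<xi> (0, c * x ^ 3)"
      by (simp only: F_def distrib_right[of v w x] \<xi>_add)
    moreover have "\<xi> (0, - c * x ^ 3) = inverse (\<xi> (0, c * x ^ 3))"
      by (simp only: mult_minus_left \<psi>_uminus)
    ultimately show ?thesis
      using nonzero[of "(0, c * x ^ 3)"] by (simp add: right_diff_distrib)
  qed
  then have "(\<lambda>x. F (v + w) x * (\<xi> (0, - c * x ^ 3) - 1)) = (\<lambda>x. F v x * F w x - F (v + w) x)"
    by (rule ext)
  then show ?thesis
    using pi_J_mult[OF F_mem_J \<psi>_cubic_pi_J, of "v + w" "- c"] by argo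
qed

end

sublocale witt_character_basis \<subseteq> generating_family R U N F
proof unfold_locales
  show "\<exists>w. F w = (\<lambda>_. 1)"
    by (intro exI[of _ 0]) (simp add: F_def \<xi>_zero fun_eq_iff)
  show "\<exists>t. (\<lambda>x. F v x * F w x - F t x) \<in> pi_J" for v w
    using F_product by blast
  fix u assume u: "u \<in> U"
  \<comment> \<open>By duality the linear part of \<open>F u\<close> is the single coordinate
    \<open>N u\<close>, so \<open>u\<close> itself is the witness.\<close>
  have "(\<Sum>v\<in>U. l (u * e v) * N v x) = N u x" for x
  proof -
    have "(\<Sum>v\<in>U. l (u * e v) * N v x) = (\<Sum>v\<in>U. if v = u then N v x else 0)"
      using u by (intro sum.cong) (auto simp: dual)
    then show ?thesis
      using u finite_U by simp
  qed
  then show "\<exists>w. (\<lambda>x. F w x - 1 - \<pi> * of_int (N u x)) \<in> J 2"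
    using F_linear[of u] by auto
qed (rule F_mem_J)

lemma (in witt_character_basis) witt_sum_valuation:
  assumes "f \<ge> 1"
  shows "(\<Sum>x\<in>UNIV. \<xi> (x, 0)) \<in> I (2 * f)" "(\<Sum>x\<in>UNIV. \<xi> (x, 0)) \<notin> I (Suc (2 * f))"
proof -
  show "(\<Sum>x\<in>UNIV. \<xi> (x, 0)) \<in> I (2 * f)"
    using sum_J[OF F_mem_J[of 1]] by (simp add: F_def card_basis)
  obtain w where w: "(\<Sum>x\<in>UNIV. F w x) \<notin> I (Suc (2 * f))"
    using ex_sum_F_nonmember by (auto simp: card_basis)
  \<comment> \<open>\<open>F 0\<close> is constantly 1 with sum \<open>3 ^ f\<close> in
    \<open>I (f * 6)\<close>, and \<open>2 * f + 1 \<le> 6 * f\<close> since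
    \<open>f \<ge> 1\<close>.\<close>
  have "w \<noteq> 0"
  proof
    assume "w = 0"
    have "3 ^ f \<in> I (Suc (2 * f))"
      using assms by (intro I_mono[OF I_power[OF I_3]]) simp
    moreover have "(\<Sum>x\<in>UNIV. F w x) = 3 ^ f"
      by (simp add: F_def \<open>w = 0\<close> \<xi>_zero card)
    ultimately show False
      using w by simp
  qed
  have "bij ((*) w)"
    using \<open>w \<noteq> 0\<close> by (intro bij_betwI[where g = "\<lambda>x. x / w"]) auto
  then have "(\<Sum>x\<in>UNIV. F w x) = (\<Sum>x\<in>UNIV. \<xi> (x, 0))"
    unfolding F_def by (rule sum.reindex_bij_betw)
  with w show "(\<Sum>x\<in>UNIV. \<xi> (x, 0)) \<notin> I (Suc (2 * f))"
    by simp
qed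

lemma (in witt_character) witt_sum_valuation:
  assumes "f \<ge> 1"
  shows "(\<Sum>x\<in>UNIV. \<xi> (x, 0)) \<in> I (2 * f) \<and> (\<Sum>x\<in>UNIV. \<xi> (x, 0)) \<notin> I (Suc (2 * f))"
proof -
  obtain U e where 1: "finite U" and 2: "\<And>u v. u \<in> U \<Longrightarrow> v \<in> U \<Longrightarrow> l (v * e u) = (if u = v then 1 else 0)"
    and 3: "\<And>x. (\<And>u. u \<in> U \<Longrightarrow> l (u * x) = 0) \<Longrightarrow> x = 0"
    using ex_dual_basis by blast
  interpret witt_character_basis R \<xi> f U e
    by unfold_locales (fact 1, fact 2, fact 3)
  show ?thesis
    using witt_sum_valuation[OF assms] by blast
qed

section \<open>The prime of \<open>\<rat>(\<zeta>\<^sub>9)\<close> above 3\<close>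

lemma complex_ring_uminus: "\<ominus>\<^bsub>complex_ring\<^esub> x = - x"
proof -
  interpret ring complex_ring
    by (rule ring_from_type_algebra)
  show ?thesis
    by (rule minus_equality) (simp_all add: ring_of_type_algebra_def)
qed

lemma complex_ring_inverse: "x \<noteq> 0 \<Longrightarrow> inv\<^bsub>complex_ring\<^esub> x = inverse x"
proof -
  interpret cring complex_ring
    by (rule cring_from_type_algebra)
  assume "x \<noteq> 0"
  then show ?thesis
    by (intro comm_inv_char) (simp_all add: ring_of_type_algebra_def)
qed

lemma Q_zeta9_uminus: "x \<in> Q_zeta9 \<Longrightarrow> - x \<in> Q_zeta9"
  using generate_field.a_inv[of x complex_ring "{zeta9}"] by (simp add: Q_zeta9_def complex_ring_uminus)

lemma Q_zeta9_zero: "0 \<in> Q_zeta9"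
  using Q_zeta9_closed(3)[OF Q_zeta9_closed(1) Q_zeta9_uminus[OF Q_zeta9_closed(1)]] by simp

lemma Q_zeta9_of_int: "of_int n \<in> Q_zeta9"
proof -
  have "of_nat m \<in> Q_zeta9" for m
    by (induction m) (auto intro: Q_zeta9_closed Q_zeta9_zero)
  then show ?thesis
    by (cases n) (auto simp del: of_nat_Suc intro: Q_zeta9_uminus)
qed

text \<open>The ring \<open>\<int>[\<pi>] = \<int>[\<zeta>\<^sub>9]\<close>, in Horner form.\<close>

inductive_set Z_pi :: "complex set" where
  Z_pi_zero: "0 \<in> Z_pi"
| Z_pi_step: "y \<in> Z_pi \<Longrightarrow> of_int c + \<pi> * y \<in> Z_pi"

lemma Z_pi_of_int: "of_int c \<in> Z_pi"
  using Z_pi_step[OF Z_pi_zero, of c] by simp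

lemma Z_pi_mult_pi: "y \<in> Z_pi \<Longrightarrow> \<pi> * y \<in> Z_pi"
  using Z_pi_step[of y 0] by simp

lemma Z_pi_add: "x \<in> Z_pi \<Longrightarrow> y \<in> Z_pi \<Longrightarrow> x + y \<in> Z_pi"
proof (induction arbitrary: y rule: Z_pi.induct)
  case (Z_pi_step x c)
  from Z_pi_step.prems show ?case
  proof cases
    case Z_pi_zero
    then show ?thesis
      using Z_pi.Z_pi_step[OF Z_pi_step.hyps] by simp
  next
    case (Z_pi_step z d)
    then show ?thesis
      using Z_pi.Z_pi_step[OF Z_pi_step.IH[of z], of "c + d"] \<open>x \<in> Z_pi\<close> by (simp add: algebra_simps)
  qed
qed simp

lemma Z_pi_mult_int: "x \<in> Z_pi \<Longrightarrow> of_int n * x \<in> Z_pi"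
proof (induction rule: Z_pi.induct)
  case (Z_pi_step x c)
  then show ?case
    using Z_pi.Z_pi_step[of "of_int n * x" "n * c"] by (simp add: algebra_simps)
qed (simp add: Z_pi_zero)

lemma Z_pi_mult: "x \<in> Z_pi \<Longrightarrow> y \<in> Z_pi \<Longrightarrow> x * y \<in> Z_pi"
proof (induction rule: Z_pi.induct)
  case (Z_pi_step x c)
  then show ?case
    using Z_pi_add[OF Z_pi_mult_int[of y c] Z_pi_mult_pi[of "x * y"]] by (simp add: algebra_simps)
qed (simp add: Z_pi_zero)

lemma Z_pi_power: "x \<in> Z_pi \<Longrightarrow> x ^ n \<in> Z_pi"
  using Z_pi_of_int[of 1] by (induction n) (auto intro: Z_pi_mult)

lemma Z_pi_uminus: "x \<in> Z_pi \<Longrightarrow> - x \<in> Z_pi"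
  using Z_pi_mult_int[of x "-1"] by simp

lemma Z_pi_numeral: "numeral k \<in> Z_pi"
  using Z_pi_of_int[of "numeral k"] by simp

lemma Z_pi_one: "1 \<in> Z_pi"
  using Z_pi_of_int[of 1] by simp

lemma Z_pi_pi: "\<pi> \<in> Z_pi"
  using Z_pi_mult_pi[OF Z_pi_one] by simp

lemma Z_pi_zeta9: "zeta9 \<in> Z_pi"
  using Z_pi_add[OF Z_pi_one Z_pi_pi] by (simp add: \<pi>_def)

lemma Z_pi_three: "3 / \<pi> ^ 6 \<in> Z_pi"
  unfolding three_over_pi_power diff_conv_add_uminus
  by (intro Z_pi_add Z_pi_mult Z_pi_uminus Z_pi_numeral Z_pi_power Z_pi_zeta9)

lemma Z_pi_three_over_pi: "3 / \<pi> \<in> Z_pi"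
proof -
  have "3 / \<pi> = \<pi> ^ 5 * (3 / \<pi> ^ 6)"
    using pi_nonzero power_Suc2[of \<pi> 5] by (simp add: divide_simps)
  then show ?thesis
    by (simp only:) (intro Z_pi_mult Z_pi_power Z_pi_pi Z_pi_three)
qed

lemma Z_pi_pi_power: "\<pi> ^ 6 / 3 \<in> Z_pi"
proof -
  have "x / 3 = - y" if "3 * y = - x" for x y :: complex
    using that by (metis minus_divide_left minus_minus nonzero_mult_div_cancel_left zero_neq_numeral)
  from this[OF three_pi_expansion] have "\<pi> ^ 6 / 3 = - (1 + 3 * \<pi> + 6 * \<pi>^2 + 7 * \<pi>^3 + 5 * \<pi>^4 + 2 * \<pi>^5)"
    .
  then show ?thesis
    by (simp only:) (intro Z_pi_add Z_pi_mult Z_pi_uminus Z_pi_numeral Z_pi_power Z_pi_pi Z_pi_one)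
qed

lemma decompose_3:
  assumes "n \<noteq> 0"
  obtains k m where "n = 3 ^ k * m" "\<not> 3 dvd (m :: int)"
proof -
  have "\<not> is_unit (3 :: int)"
    by simp
  with assms show thesis
    using multiplicity_decompose'[of n 3] that by metis
qed

lemma bezout_3:
  assumes "\<not> 3 dvd m"
  obtains a b where "a * m + b * 3 = (1 :: int)"
proof -
  have "gcd 3 m = 1"
    by (rule coprime_imp_gcd_eq_1, rule prime_imp_coprime) (use assms in simp_all)
  then show thesis
    using that bezout_int[of m 3] by (auto simp: gcd.commute)
qed

text \<open>After powers of the variable are cancelled, as \<open>y \<noteq> 0\<close> allows, an
  integral equation reads \<open>n + y * q(y) = 0\<close> with \<open>n \<noteq> 0\<close>; then
  \<open>z = - q(y)\<close>.\<close>

lemma integral_inverse: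
  assumes S: "\<And>n. of_int n \<in> S" "\<And>x y. x \<in> S \<Longrightarrow> y \<in> S \<Longrightarrow> x + y \<in> S" "\<And>x y. x \<in> S \<Longrightarrow> y \<in> S \<Longrightarrow> x * y \<in> S"
    and y: "y \<in> S" "y \<noteq> 0" "algebraic_int (y :: complex)"
  obtains z n where "z \<in> S" "n \<noteq> 0" "y * z = of_int n"
proof -
  have poly_S: "poly q y \<in> S" if "\<forall>i. Polynomial.coeff q i \<in> \<int>" for q
    using that
  proof (induction q)
    case 0
    then show ?case
      using S(1)[of 0] by simp
  next
    case (pCons a q)
    then have "\<forall>i. Polynomial.coeff q i \<in> \<int>" "a \<in> \<int>"
      by (metis coeff_pCons_Suc, metis coeff_pCons_0)
    then show ?case
      using pCons.IH S y by (auto simp: Ints_def)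
  qed
  have "\<exists>z\<in>S. \<exists>n. n \<noteq> 0 \<and> y * z = of_int n"
    if "p \<noteq> 0" "\<forall>i. Polynomial.coeff p i \<in> \<int>" "poly p y = 0" for p
    using that
  proof (induction p)
    case (pCons a q)
    have q: "\<forall>i. Polynomial.coeff q i \<in> \<int>" and "a \<in> \<int>"
      using pCons.prems by (metis coeff_pCons_Suc, metis coeff_pCons_0)
    then obtain n where n: "a = of_int n"
      by (auto simp: Ints_def)
    show ?case
    proof (cases "n = 0")
      case True
      then show ?thesis
        using pCons q n y by auto
    next
      case False
      have "y * (of_int (-1) * poly q y) = of_int n"
        using pCons.prems(3) n by (simp add: add_eq_0_iff)
      then show ?thesis
        using False S(3)[OF S(1) poly_S[OF q]] by blast
    qed
  qed simp
  moreover obtain p where "Polynomial.lead_coeff p = 1" "\<forall>i. Polynomial.coeff p i \<in> \<int>" "poly p y = 0"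
    using y(3) by (auto elim: algebraic_int.cases)
  moreover from this(1) have "p \<noteq> 0"
    by auto
  ultimately show thesis
    using that by blast
qed

section \<open>The ring of integers and its ideal \<open>P\<close>, generated by
  \<open>\<pi>\<close>\<close>

locale prime_above_3 =
  fixes P :: "complex set"
  assumes prime: "primeideal P (ring_of_integers Q_zeta9)"
    and three: "3 \<in> P"
begin

definition OK :: "complex set" where
  "OK = {x \<in> Q_zeta9. algebraic_int x}"

lemma ring_of_integers_simps:
  "carrier (ring_of_integers Q_zeta9) = OK"
  "x \<otimes>\<^bsub>ring_of_integers Q_zeta9\<^esub> y = x * y"
  "x \<oplus>\<^bsub>ring_of_integers Q_zeta9\<^esub> y = x + y"
  "\<one>\<^bsub>ring_of_integers Q_zeta9\<^esub> = 1"
  by (simp_all add: ring_of_integers_def ring_of_type_algebra_def OK_def)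

interpretation primeideal P "ring_of_integers Q_zeta9"
  by (rule prime)

text \<open>That sums and products of algebraic integers are integral is part of the hypothesis on \<open>P\<close>.\<close>

lemma OK_add: "x \<in> OK \<Longrightarrow> y \<in> OK \<Longrightarrow> x + y \<in> OK"
  using add.m_closed[of x y] by (simp add: ring_of_integers_simps)

lemma OK_mult: "x \<in> OK \<Longrightarrow> y \<in> OK \<Longrightarrow> x * y \<in> OK"
  using m_closed[of x y] by (simp add: ring_of_integers_simps)

lemma OK_uminus: "x \<in> OK \<Longrightarrow> - x \<in> OK"
  by (auto simp: OK_def intro: Q_zeta9_uminus)

lemma OK_of_int: "of_int n \<in> OK"
  by (auto simp: OK_def Q_zeta9_of_int)

lemma OK_numeral: "numeral k \<in> OK"
  using OK_of_int[of "numeral k"] by simp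

lemma OK_one: "1 \<in> OK"
  using OK_of_int[of 1] by simp

lemma OK_power: "x \<in> OK \<Longrightarrow> x ^ n \<in> OK"
  by (induction n) (auto intro: OK_mult OK_one)

lemma OK_zeta9: "zeta9 \<in> OK"
proof -
  have "algebraic_int zeta9"
    by (rule algebraic_int_root[where p = "Polynomial.monom 1 9" and y = 1])
       (auto simp: poly_monom zeta9_power_9 degree_monom_eq)
  then show ?thesis
    by (simp add: OK_def Q_zeta9_closed)
qed

lemma OK_pi: "\<pi> \<in> OK"
  using OK_add[OF OK_zeta9 OK_uminus[OF OK_one]] by (simp add: \<pi>_def)

lemma Z_pi_OK: "x \<in> Z_pi \<Longrightarrow> x \<in> OK"
  by (induction rule: Z_pi.induct) (use OK_of_int[of 0] in \<open>auto intro: OK_add OK_mult OK_of_int OK_pi\<close>)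

lemma OK_subset: "x \<in> OK \<Longrightarrow> x \<in> Q_zeta9"
  by (simp add: OK_def)

lemma P_OK: "x \<in> P \<Longrightarrow> x \<in> OK"
  using Icarr by (simp add: ring_of_integers_simps)

lemma P_add: "x \<in> P \<Longrightarrow> y \<in> P \<Longrightarrow> x + y \<in> P"
  using additive_subgroup.a_closed[OF additive_subgroup_axioms, of x y]
  by (simp add: ring_of_integers_simps)

lemma P_mult: "x \<in> P \<Longrightarrow> y \<in> OK \<Longrightarrow> y * x \<in> P"
  using I_l_closed[of x y] by (simp add: ring_of_integers_simps)

lemma P_prime: "x \<in> OK \<Longrightarrow> y \<in> OK \<Longrightarrow> x * y \<in> P \<Longrightarrow> x \<in> P \<or> y \<in> P"
  using I_prime[of x y] by (simp add: ring_of_integers_simps)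

lemma one_notin_P: "1 \<notin> P"
  using one_imp_carrier I_notcarr by (auto simp: ring_of_integers_simps)

text \<open>\<open>\<pi> ^ 6\<close> is an integral multiple of 3, and \<open>P\<close> is
  prime.\<close>

lemma pi_in_P: "\<pi> \<in> P"
proof -
  have "\<pi> ^ 6 / 3 * 3 \<in> P"
    using Z_pi_OK[OF Z_pi_pi_power] by (rule P_mult[OF three])
  moreover have "\<pi> ^ n \<in> P \<Longrightarrow> \<pi> \<in> P" for n
    using one_notin_P P_prime[OF OK_pi OK_power[OF OK_pi]] by (induction n) auto
  ultimately show ?thesis
    by simp
qed

lemma of_int_in_P: "of_int c \<in> P \<longleftrightarrow> 3 dvd c"
proof
  show "of_int c \<in> P" if "3 dvd c"
    using that P_mult[OF three OK_of_int] by (auto simp: mult.commute elim!: dvdE)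
  show "3 dvd c" if c: "of_int c \<in> P"
  proof (rule ccontr)
    assume "\<not> 3 dvd c"
    then obtain a b where "a * c + b * 3 = 1"
      by (rule bezout_3)
    then have "of_int a * of_int c + of_int b * 3 = (1 :: complex)"
      by (metis of_int_1 of_int_add of_int_mult of_int_numeral)
    then show False
      using P_add[OF P_mult[OF c OK_of_int[of a]] P_mult[OF three OK_of_int[of b]]] one_notin_P by simp
  qed
qed

lemma of_int_over_pi:
  assumes "of_int c / \<pi> \<in> OK"
  shows "3 dvd c" "of_int c / \<pi> \<in> Z_pi"
proof -
  have "of_int c / \<pi> * \<pi> \<in> P"
    using assms by (rule P_mult[OF pi_in_P])
  then show "3 dvd c"
    by (simp add: pi_nonzero of_int_in_P)
  then obtain d where d: "c = 3 * d"
    by auto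
  from Z_pi_mult_int[OF Z_pi_three_over_pi, of d] show "of_int c / \<pi> \<in> Z_pi"
    by (simp add: d mult.commute)
qed

text \<open>Only the constant term of the Horner form matters: it must be divisible by 3, and
  \<open>3 / \<pi>\<close> lies in \<open>Z_pi\<close>.\<close>

lemma Z_pi_divide_pi:
  assumes "y \<in> Z_pi" "y / \<pi> \<in> OK"
  shows "y / \<pi> \<in> Z_pi"
  using assms(1)
proof cases
  case (Z_pi_step z c)
  have "y / \<pi> + - z \<in> OK"
    using assms(2) Z_pi_OK[OF Z_pi_step(2)] by (intro OK_add OK_uminus)
  then have "of_int c / \<pi> \<in> OK"
    using pi_nonzero by (simp add: Z_pi_step add_divide_distrib)
  from Z_pi_add[OF of_int_over_pi(2)[OF this] Z_pi_step(2)] show ?thesis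
    using pi_nonzero by (simp add: Z_pi_step add_divide_distrib)
qed (simp add: Z_pi_zero)

lemma Z_pi_divide_pi_power: "y \<in> Z_pi \<Longrightarrow> y / \<pi> ^ n \<in> OK \<Longrightarrow> y / \<pi> ^ n \<in> Z_pi"
proof (induction n arbitrary: y)
  case (Suc n)
  have "\<pi> ^ n * (y / \<pi> ^ Suc n) \<in> OK"
    using Suc.prems by (intro OK_mult OK_power OK_pi)
  then have "y / \<pi> \<in> Z_pi"
    using Suc.prems pi_nonzero by (intro Z_pi_divide_pi) simp_all
  then show ?case
    using Suc.IH[of "y / \<pi>"] Suc.prems by (simp add: divide_divide_eq_left)
qed simp

text \<open>The case of inverses rests on \<open>integral_inverse\<close>, which turns the numerator
  into an integer denominator.\<close>

lemma Q_zeta9_quotient: "x \<in> Q_zeta9 \<Longrightarrow> \<exists>y\<in>Z_pi. \<exists>n. n \<noteq> 0 \<and> x = y / of_int n"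
  unfolding Q_zeta9_def
proof (induction rule: generate_field.induct)
  case one
  show ?case
    using Z_pi_one by (intro bexI[of _ 1] exI[of _ 1]) (simp_all add: ring_of_type_algebra_def)
next
  case (incl h)
  then show ?case
    using Z_pi_zeta9 by (intro bexI[of _ zeta9] exI[of _ 1]) simp_all
next
  case (a_inv h)
  then show ?case
    using Z_pi_uminus by (metis complex_ring_uminus minus_divide_left)
next
  case (m_inv h)
  then obtain y n where y: "y \<in> Z_pi" "n \<noteq> 0" "h = y / of_int n"
    by auto
  moreover have h: "h \<noteq> 0"
    using m_inv.hyps(2) by (simp add: ring_of_type_algebra_def)
  ultimately have "y \<noteq> 0"
    by auto
  moreover have "algebraic_int y"
    using Z_pi_OK[OF y(1)] by (simp add: OK_def)
  ultimately obtain z m where z: "z \<in> Z_pi" "m \<noteq> 0" "y * z = of_int m"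
    using integral_inverse[of Z_pi y] Z_pi_of_int Z_pi_add Z_pi_mult y(1) by blast
  have "z \<noteq> 0"
    using z(2,3) by auto
  then have "inverse h = of_int n * z / (y * z)"
    using y(3) by simp
  then have "inverse h = of_int n * z / of_int m"
    by (simp only: z(3))
  then show ?case
    using z Z_pi_mult_int complex_ring_inverse[OF h] by metis
next
  case (eng_add h k)
  then obtain y n z m where "y \<in> Z_pi" "n \<noteq> 0" "h = y / of_int n" "z \<in> Z_pi" "m \<noteq> 0" "k = z / of_int m"
    by auto
  then have "of_int m * y + of_int n * z \<in> Z_pi" "n * m \<noteq> 0"
    "h + k = (of_int m * y + of_int n * z) / of_int (n * m)"
    by (simp_all add: Z_pi_add Z_pi_mult Z_pi_of_int add_frac_eq mult.commute)
  then have "\<exists>y\<in>Z_pi. \<exists>n. n \<noteq> 0 \<and> h + k = y / of_int n"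
    by blast
  then show ?case
    by (simp add: ring_of_type_algebra_def)
next
  case (eng_mult h k)
  then obtain y n z m where "y \<in> Z_pi" "n \<noteq> 0" "h = y / of_int n" "z \<in> Z_pi" "m \<noteq> 0" "k = z / of_int m"
    by auto
  then have "y * z \<in> Z_pi" "n * m \<noteq> 0" "h * k = (y * z) / of_int (n * m)"
    by (auto intro: Z_pi_mult)
  then have "\<exists>y\<in>Z_pi. \<exists>n. n \<noteq> 0 \<and> h * k = y / of_int n"
    by blast
  then show ?case
    by (simp add: ring_of_type_algebra_def)
qed

text \<open>Write \<open>x\<close> over an integer. The 3-part of this denominator becomes a power
  of \<open>\<pi>\<close>, handled by \<open>Z_pi_divide_pi_power\<close>; the factor
  \<open>m\<close> prime to 3 is inverted modulo 3 by Bezout.\<close>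

lemma OK_residue:
  assumes "x \<in> OK"
  obtains c w where "w \<in> OK" "x = of_int c + \<pi> * w"
proof -
  obtain y n where y: "y \<in> Z_pi" "n \<noteq> 0" "x = y / of_int n"
    using Q_zeta9_quotient[OF OK_subset[OF assms]] by auto
  obtain k m where n: "n = 3 ^ k * m" "\<not> 3 dvd m"
    using decompose_3[OF y(2)] .
  have "y * (\<pi> ^ 6 / 3) ^ k / \<pi> ^ (6 * k) = of_int m * x"
  proof -
    have "(\<pi> ^ 6 / 3) ^ k / \<pi> ^ (6 * k) = 1 / 3 ^ k"
      using pi_nonzero by (simp add: power_divide power_mult)
    then have "y * (\<pi> ^ 6 / 3) ^ k / \<pi> ^ (6 * k) = y / 3 ^ k"
      by (simp only: times_divide_eq_right[symmetric]) simp
    then show ?thesis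
      using y(2,3) n(1) by simp
  qed
  moreover have "of_int m * x \<in> OK"
    by (intro OK_mult OK_of_int assms)
  moreover have "y * (\<pi> ^ 6 / 3) ^ k \<in> Z_pi"
    by (intro Z_pi_mult y Z_pi_power Z_pi_pi_power)
  ultimately have "of_int m * x \<in> Z_pi"
    using Z_pi_divide_pi_power[of "y * (\<pi> ^ 6 / 3) ^ k" "6 * k"] by simp
  then obtain c z where c: "of_int m * x = of_int c + \<pi> * z" "z \<in> OK"
  proof cases
    case Z_pi_zero
    then show ?thesis
      using that[of 0 0] OK_of_int[of 0] by simp
  qed (use that Z_pi_OK in blast)
  obtain a b where ab: "a * m + b * 3 = 1"
    using bezout_3[OF n(2)] .
  have "x = of_int (a * m + b * 3) * x"
    by (simp add: ab)
  also have "\<dots> = of_int a * (of_int m * x) + of_int b * 3 * x"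
    by (simp add: algebra_simps)
  also have "of_int b * 3 * x = \<pi> * (of_int b * (3 / \<pi>) * x)"
    using pi_nonzero by simp
  finally have "x = of_int (a * c) + \<pi> * (of_int a * z + of_int b * (3 / \<pi>) * x)"
    by (simp only: c(1) of_int_mult distrib_left mult.assoc mult.left_commute[of _ \<pi>] add.assoc)
  moreover have "of_int a * z + of_int b * (3 / \<pi>) * x \<in> OK"
    by (intro OK_add OK_mult OK_of_int c assms Z_pi_OK[OF Z_pi_three_over_pi])
  ultimately show thesis
    using that by blast
qed

text \<open>By \<open>OK_residue\<close> only the integer \<open>c\<close> can obstruct divisibility
  by \<open>\<pi>\<close>, and an integer in \<open>P\<close> is a multiple of 3.\<close>

lemma P_iff: "x \<in> P \<longleftrightarrow> x / \<pi> \<in> OK"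
proof
  assume x: "x \<in> P"
  obtain c w where cw: "w \<in> OK" "x = of_int c + \<pi> * w"
    using OK_residue[OF P_OK[OF x]] .
  have "x + - w * \<pi> \<in> P"
    by (intro P_add x P_mult pi_in_P OK_uminus cw)
  then have "3 dvd c"
    by (simp add: cw of_int_in_P mult.commute)
  then obtain d where d: "c = 3 * d"
    by auto
  have "x / \<pi> = of_int d * (3 / \<pi>) + w"
    using pi_nonzero by (simp add: cw d add_divide_distrib)
  also have "\<dots> \<in> OK"
    by (intro OK_add OK_mult OK_of_int cw Z_pi_OK[OF Z_pi_three_over_pi])
  finally show "x / \<pi> \<in> OK" .
next
  assume "x / \<pi> \<in> OK"
  from P_mult[OF pi_in_P this] show "x \<in> P"
    by (simp add: pi_nonzero)
qed

lemma OK_Suc: "x / \<pi> ^ Suc n \<in> OK \<Longrightarrow> x / \<pi> ^ n \<in> OK"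
  using OK_mult[OF OK_pi, of "x / \<pi> ^ Suc n"] by (simp add: pi_nonzero)

lemma OK_antimono: "x / \<pi> ^ n \<in> OK \<Longrightarrow> m \<le> n \<Longrightarrow> x / \<pi> ^ m \<in> OK"
  by (induction n arbitrary: m) (auto intro: OK_Suc simp: le_Suc_eq simp del: power_Suc)

lemma P_power: "P [^]\<^bsub>ideals_set (ring_of_integers Q_zeta9)\<^esub> (n::nat) = {x. x / \<pi> ^ n \<in> OK}"
proof (induction n)
  case 0
  show ?case
    by (simp add: ideals_set_def ring_of_integers_simps)
next
  case (Suc n)
  let ?R = "ring_of_integers Q_zeta9"
  have "ideal_prod ?R {x. x / \<pi> ^ n \<in> OK} P = {x. x / \<pi> ^ Suc n \<in> OK}"
  proof (intro equalityI subsetI)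
    fix x assume "x \<in> ideal_prod ?R {x. x / \<pi> ^ n \<in> OK} P"
    then show "x \<in> {x. x / \<pi> ^ Suc n \<in> OK}"
    proof (induction rule: ideal_prod.induct)
      case (prod i j)
      then have "(i / \<pi> ^ n) * (j / \<pi>) \<in> OK"
        by (intro OK_mult) (simp_all add: P_iff)
      then show ?case
        by (simp add: ring_of_integers_simps mult.commute)
    next
      case (sum s t)
      then show ?case
        by (simp add: ring_of_integers_simps add_divide_distrib OK_add)
    qed
  next
    fix x assume "x \<in> {x. x / \<pi> ^ Suc n \<in> OK}"
    then have "x / \<pi> \<in> {x. x / \<pi> ^ n \<in> OK}"
      by (simp add: mult.commute)
    from ideal_prod.prod[OF this pi_in_P, of ?R] show "x \<in> ideal_prod ?R {x. x / \<pi> ^ n \<in> OK} P"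
      by (simp add: ring_of_integers_simps pi_nonzero)
  qed
  then show ?case
    by (simp add: Suc) (simp add: ideals_set_def)
qed

section \<open>The order at \<open>P\<close>\<close>

definition has_ord :: "complex \<Rightarrow> nat \<Rightarrow> bool" where
  "has_ord x n \<longleftrightarrow> x / \<pi> ^ n \<in> OK \<and> x / \<pi> ^ Suc n \<notin> OK"

lemma has_ord_ideal_ord:
  assumes "has_ord x n"
  shows "ideal_ord Q_zeta9 P x = n"
  unfolding ideal_ord_def P_power
proof (rule Greatest_equality)
  show "x \<in> {x. x / \<pi> ^ n \<in> OK}"
    using assms by (simp add: has_ord_def)
  fix m assume "x \<in> {x. x / \<pi> ^ m \<in> OK}"
  then show "m \<le> n"
    using assms OK_antimono[of x m "Suc n"] unfolding has_ord_def by (meson mem_Collect_eq not_less_eq_eq)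
qed

lemma has_ord_mult:
  assumes "has_ord x m" "has_ord y n"
  shows "has_ord (x * y) (m + n)"
  unfolding has_ord_def
proof
  show "x * y / \<pi> ^ (m + n) \<in> OK"
    using assms OK_mult[of "x / \<pi> ^ m" "y / \<pi> ^ n"] by (simp add: has_ord_def power_add)
  show "x * y / \<pi> ^ Suc (m + n) \<notin> OK"
  proof
    assume "x * y / \<pi> ^ Suc (m + n) \<in> OK"
    then have "(x / \<pi> ^ m) * (y / \<pi> ^ n) \<in> P"
      by (simp add: P_iff power_add mult_ac)
    then have "x / \<pi> ^ m \<in> P \<or> y / \<pi> ^ n \<in> P"
      using assms by (intro P_prime) (auto simp: has_ord_def)
    then show False
      using assms by (auto simp: has_ord_def P_iff mult.commute)
  qed
qed

text \<open>\<open>x\<close> divides a nonzero integer \<open>3 ^ k * m\<close> with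
  \<open>m\<close> prime to 3, so \<open>\<pi> ^ (6 * k + 1)\<close> cannot divide
  \<open>x\<close>.\<close>

lemma ex_has_ord:
  assumes "x \<in> OK" "x \<noteq> 0"
  shows "\<exists>n. has_ord x n"
proof -
  obtain z n where z: "z \<in> OK" "n \<noteq> 0" "x * z = of_int n"
    using integral_inverse[of OK x] OK_of_int OK_add OK_mult assms by (auto simp: OK_def)
  obtain k m where n: "n = 3 ^ k * m" "\<not> 3 dvd m"
    using decompose_3[OF z(2)] .
  have "x / \<pi> ^ Suc (6 * k) \<notin> OK"
  proof
    assume "x / \<pi> ^ Suc (6 * k) \<in> OK"
    then have "(\<pi> ^ 6 / 3) ^ k * (z * (x / \<pi> ^ Suc (6 * k))) \<in> OK"
      by (intro OK_mult OK_power z Z_pi_OK[OF Z_pi_pi_power])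
    also have "(\<pi> ^ 6 / 3) ^ k * (z * (x / \<pi> ^ Suc (6 * k))) = (\<pi> ^ 6 / 3) ^ k * of_int n / \<pi> ^ Suc (6 * k)"
      by (simp add: z(3)[symmetric])
    also have "\<dots> = of_int m / \<pi>"
      using pi_nonzero by (simp add: n power_divide power_mult)
    finally show False
      using of_int_over_pi(1) n(2) by blast
  qed
  then obtain j where j: "x / \<pi> ^ j \<notin> OK" "\<And>i. i < j \<Longrightarrow> x / \<pi> ^ i \<in> OK"
    using exists_least_iff[of "\<lambda>j. x / \<pi> ^ j \<notin> OK"] by blast
  \<comment> \<open>The first failing exponent \<open>j\<close> is positive since \<open>x\<close>
    is integral; the order is \<open>j - 1\<close>.\<close>
  then have "j \<noteq> 0"
    using assms(1) by (intro notI) simp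
  then show ?thesis
    using j by (intro exI[of _ "j - 1"]) (simp add: has_ord_def)
qed

lemma one_over_pi: "1 / \<pi> \<notin> OK"
  using of_int_over_pi(1)[of 1] by auto

text \<open>The fraction \<open>x / 1\<close> gives existence. For any other fraction
  \<open>a / b\<close>, orders add in \<open>a = x * b\<close>, which gives uniqueness.\<close>

lemma prime_ord_eq:
  assumes "x \<in> OK" "x \<noteq> 0" "has_ord x n"
  shows "prime_ord Q_zeta9 P x = int n"
  unfolding prime_ord_def ring_of_integers_simps
proof (rule the_equality)
  have "has_ord 1 0"
    using one_over_pi OK_one by (simp add: has_ord_def)
  then show "\<exists>a\<in>OK - {0}. \<exists>b\<in>OK - {0}. x = a / b \<and>
      int n = int (ideal_ord Q_zeta9 P a) - int (ideal_ord Q_zeta9 P b)"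
    using assms OK_one by (intro bexI[of _ x] bexI[of _ 1]) (simp_all add: has_ord_ideal_ord)
next
  fix k
  assume "\<exists>a\<in>OK - {0}. \<exists>b\<in>OK - {0}. x = a / b \<and>
      k = int (ideal_ord Q_zeta9 P a) - int (ideal_ord Q_zeta9 P b)"
  then obtain a b where ab: "b \<in> OK" "b \<noteq> 0" "x = a / b"
    "k = int (ideal_ord Q_zeta9 P a) - int (ideal_ord Q_zeta9 P b)"
    by auto
  obtain m where m: "has_ord b m"
    using ex_has_ord ab by blast
  have "has_ord a (n + m)"
    using has_ord_mult[OF assms(3) m] ab by simp
  then show "k = int n"
    using m ab by (simp add: has_ord_ideal_ord)
qed

lemma has_ord_three: "has_ord 3 6"
proof -
  have "3 / \<pi> ^ Suc 6 \<notin> OK"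
  proof
    assume "3 / \<pi> ^ Suc 6 \<in> OK"
    from OK_mult[OF Z_pi_OK[OF Z_pi_pi_power] this] have "1 / \<pi> \<in> OK"
      using pi_nonzero by (simp only: power_Suc) simp
    then show False
      using one_over_pi by simp
  qed
  then show ?thesis
    using Z_pi_OK[OF Z_pi_three] by (simp add: has_ord_def)
qed

text \<open>Interpolation at \<open>-1, 0, 1\<close> needs \<open>1 / 2\<close>; inverting 2 does not affect valuations above 3.\<close>

definition OK_half :: "complex set" where
  "OK_half = {x. \<exists>k. 2 ^ k * x \<in> OK}"

lemma OK_subset_half: "x \<in> OK \<Longrightarrow> x \<in> OK_half"
  unfolding OK_half_def by (auto intro: exI[of _ 0])

lemma uniformized_ring_OK_half: "uniformized_ring OK_half"
proof
  fix x y
  assume "x \<in> OK_half" "y \<in> OK_half"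
  then obtain j k where jk: "2 ^ j * x \<in> OK" "2 ^ k * y \<in> OK"
    by (auto simp: OK_half_def)
  have "2 ^ k * (2 ^ j * x) + 2 ^ j * (2 ^ k * y) \<in> OK"
    by (intro OK_add OK_mult OK_power OK_numeral jk)
  then have "2 ^ (j + k) * (x + y) \<in> OK"
    by (simp add: power_add algebra_simps)
  then show "x + y \<in> OK_half"
    unfolding OK_half_def by blast
  have "2 ^ (j + k) * (x * y) \<in> OK"
    using OK_mult[OF jk] by (simp add: power_add algebra_simps)
  then show "x * y \<in> OK_half"
    unfolding OK_half_def by blast
next
  fix x assume "x \<in> OK_half"
  then show "- x \<in> OK_half"
    using OK_uminus by (fastforce simp: OK_half_def)
next
  show "1 \<in> OK_half" "zeta9 \<in> OK_half"
    by (intro OK_subset_half OK_one OK_zeta9)+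
  have "2 ^ 1 * (1 / 2) \<in> OK"
    using OK_one by simp
  then show "1 / 2 \<in> OK_half"
    unfolding OK_half_def by blast
  show "1 / \<pi> \<notin> OK_half"
  proof
    assume "1 / \<pi> \<in> OK_half"
    then obtain k where "of_int (2 ^ k) / \<pi> \<in> OK"
      by (auto simp: OK_half_def)
    then have "3 dvd (2 ^ k :: int)"
      by (rule of_int_over_pi)
    then have "3 dvd (2 :: int)"
      by (rule prime_dvd_power[rotated]) simp
    then show False
      by simp
  qed
qed

text \<open>Bezout for \<open>2 ^ k\<close> and \<open>3 ^ f\<close>: the multiple by
  \<open>2 ^ k\<close> is integral by assumption, the one by \<open>3 ^ f\<close> because
  \<open>\<pi> ^ 6\<close> divides 3.\<close>

lemma OK_half_power:
  assumes "x \<in> OK" "x / \<pi> ^ (2 * f) \<in> OK_half"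
  shows "x / \<pi> ^ (2 * f) \<in> OK"
proof -
  obtain k where k: "2 ^ k * (x / \<pi> ^ (2 * f)) \<in> OK"
    using assms by (auto simp: OK_half_def)
  have "gcd (2 ^ k) (3 ^ f :: int) = 1"
    by (intro coprime_imp_gcd_eq_1) simp
  then obtain a b where ab: "a * 2 ^ k + b * 3 ^ f = (1 :: int)"
    using bezout_int[of "2 ^ k" "3 ^ f"] by auto
  have "x / \<pi> ^ (2 * f) = of_int (a * 2 ^ k + b * 3 ^ f) * (x / \<pi> ^ (2 * f))"
    by (simp only: ab of_int_1 mult_1)
  also have "\<dots> = of_int a * (2 ^ k * (x / \<pi> ^ (2 * f))) + of_int b * (\<pi> ^ (4 * f) * (3 / \<pi> ^ 6) ^ f) * x"
  proof -
    have "\<pi> ^ (4 * f) * (3 / \<pi> ^ 6) ^ f = 3 ^ f / \<pi> ^ (2 * f)"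
      using pi_nonzero by (simp add: power_divide divide_simps flip: power_mult power_add)
    then show ?thesis
      by (simp add: algebra_simps)
  qed
  also have "\<dots> \<in> OK"
    by (intro OK_add OK_mult OK_of_int OK_power OK_pi k assms Z_pi_OK[OF Z_pi_three])
  finally show ?thesis .
qed

end

theorem theoremB:
  fixes \<xi> :: "'a::{field,finite} \<times> 'a \<Rightarrow> complex"
    and f :: nat
    and P :: "complex set"
  assumes "f \<ge> 1"
    and "CARD('a) = 3 ^ f"
    and "\<xi> \<in> hom witt2 (units_of complex_ring)"
    and "\<exists>b. \<xi> (0, b) \<noteq> 1"
    and "primeideal P (ring_of_integers Q_zeta9)"
    and "3 \<in> P"
  shows "(\<Sum>x\<in>UNIV. \<xi> (x, 0)) \<in> Q_zeta9 \<and>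
    normalized_valuation Q_zeta9 P 3 (\<Sum>x\<in>UNIV. \<xi> (x, 0)) = ereal (real f / 3)"
proof -
  interpret prime_above_3 P
    using assms(5,6) by (rule prime_above_3.intro)
  interpret witt_character OK_half \<xi> f
    using uniformized_ring_OK_half assms(2-4) by (simp add: witt_character_def witt_character_axioms_def)
  let ?S = "\<Sum>x\<in>UNIV. \<xi> (x, 0)"
  have S: "?S \<in> I (2 * f)" "?S \<notin> I (Suc (2 * f))"
    using witt_sum_valuation[OF assms(1)] by auto
  have "?S \<noteq> 0"
    using S(2) by (auto simp del: sum.neutral)
  have \<xi>_OK: "\<xi> w \<in> OK" for w
    using root_of_unity_9[OF power_9] OK_power[OF OK_zeta9] by metis
  have "(\<Sum>x\<in>A. \<xi> (x, 0)) \<in> OK" for A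
    by (induction A rule: infinite_finite_induct) (use OK_of_int[of 0] \<xi>_OK OK_add in auto)
  then have S_OK: "?S \<in> OK" .
  \<comment> \<open>Integrality descends from \<open>OK_half\<close> by
    \<open>OK_half_power\<close>; failure of divisibility passes to the smaller ring
    \<open>OK\<close>.\<close>
  have "has_ord ?S (2 * f)"
    unfolding has_ord_def
  proof
    show "?S / \<pi> ^ (2 * f) \<in> OK"
      using S_OK S(1) by (intro OK_half_power) (simp_all add: I_def)
    show "?S / \<pi> ^ Suc (2 * f) \<notin> OK"
      using S(2) OK_subset_half by (auto simp: I_def)
  qed
  then have "prime_ord Q_zeta9 P ?S = int (2 * f)"
    using S_OK \<open>?S \<noteq> 0\<close> by (intro prime_ord_eq)
  \<comment> \<open>The normalization divides by this order:
    \<open>2 * f / 6 = f / 3\<close>.\<close>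
  moreover have "prime_ord Q_zeta9 P 3 = int 6"
    by (rule prime_ord_eq[OF OK_numeral _ has_ord_three]) simp
  ultimately have "normalized_valuation Q_zeta9 P 3 ?S = ereal (real f / 3)"
    using \<open>?S \<noteq> 0\<close> by (simp add: normalized_valuation_def)
  then show ?thesis
    using OK_subset[OF S_OK] by blast
qed

end
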